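(* Consider the energy market model, the social welfare maximization problem (P), the agents' price responses $\mathbf x(\boldsymbol\lambda)=(\{\mathbf e^i(\boldsymbol\lambda)\}_{i\in\mathcal D},\{\mathbf p^i(\boldsymbol\lambda)\}_{i\in\mathcal G},\boldsymbol\theta(\boldsymbol\lambda))$ and the pricing process, all as defined in the context and under the standing assumptions listed there. The pricing process generates a competitive equilibrium $(\mathbf x^*,\boldsymbol\lambda^* )$, where $\boldsymbol\lambda^*$ is the converged price vector of the process and $\mathbf x^*=\mathbf x(\boldsymbol\lambda^* )$ is a globally optimal solution to Problem (P).
   Context: **Network.** A network of $N$ buses, with bus set $\mathcal N$, is connected by transmission lines given by an undirected edge set $\mathcal E$. Each $\{n,m\}\in\mathcal E$ has a line limit $K_{nm}=K_{mn}>0$, conductance $G_{nm}=G_{mn}>0$ and susceptance $B_{nm}=B_{mn}>0$; for $\{n,m\}\notin\mathcal E$ these are all $0$. Each $\{n,m\}\in\mathcal E$ also has angle difference bounds $\underline\theta_{nm},\bar\theta_{nm}$. Each bus has a voltage angle $\theta_n$; the operating point is $\boldsymbol\theta=\{\theta_n\}_{n\in\mathcal N}$, and $\theta_{nm}:=\theta_n-\theta_m$. The power flow from $n$ to $m$ is given by the convex DC approximation $$g(\theta_{nm}):=B_{nm}(\theta_n-\theta_m)+\tfrac12G_{nm}(\theta_n-\theta_m)^2,$$ and the injection induced at bus $n$ is $f_n(\boldsymbol\theta)=\sum_{m\in\mathcal N}g(\theta_{nm})$, with $\mathbf f=(f_1,\dots,f_N)$. **Agents.** There are a market operator and finite sets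 $\mathcal D,\mathcal G,\mathcal T$ of distribution companies (DistCos), generation companies (GenCos) and transmission companies (TransCos). - DistCo $i\in\mathcal D$ has elastic loads $\mathbf e^i=\{e_n^i\}$ at buses $n\in\mathcal N_{\mathcal D^e}^i\subseteq\mathcal N$ with $e_n^i\in[\underline e_n^i,\bar e_n^i]$, given inelastic loads $s_n^i\ge0$ at buses $n\in\mathcal N_{\mathcal D^s}^i\subseteq\mathcal N$, and utility functions $u_n^i$. Let $\mathbf E^i$ be the set of $\mathbf e^i$ satisfying the bounds and $\mathbf u^i(\mathbf e^i)=\sum_{n\in\mathcal N_{\mathcal D^e}^i}u_n^i(e_n^i)$. - GenCo $i\in\mathcal G$ has real power injections $\mathbf p^i=\{p_n^i\}$ at buses $n\in\mathcal N_{\mathcal G}^i\subseteq\mathcal N$ with $p_n^i\in[\underline p_n^i,\bar p_n^i]$, and cost functions $c_n^i$. Let $\mathbf P^i$ be the set of $\mathbf p^i$ satisfying the bounds and $\mathbf c^i(\mathbf p^i)=\sum_{n\in\mathcal N_{\mathcal G}^i}c_n^i(p_n^i)$. - TransCo $i\in\mathcal T$ owns the lines $\mathcal E^i$; the sets $\mathcal E^i$ are pairwise disjoint with union $\mathcal E$. $\mathcal N_{\mathcal T}^i$ is the set of endpoints of edges in $\mathcal E^i$, and $\boldsymbol\theta^i=\{\theta_n\}_{n\in\mathcal N_{\mathcal T}^i}$. Net quantities at bus $n$ are $p_n=\sum_{i\in\mathcal G}p_n^i$, $e_n=\sum_{i\in\mathcal D}e_n^i$, $s_n=\sum_{i\in\mathcal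 D}s_n^i$ (agents without such a unit at $n$ contribute nothing), with vectors $\mathbf p,\mathbf e,\mathbf s\in\mathbb R^N$. **Standing assumptions.** (a) There is a set of slack buses $\mathcal N_{\mathcal S}\subseteq\mathcal N$, serving solely as angle references ($\theta_n=0$ for $n\in\mathcal N_{\mathcal S}$), such that $\mathcal N_{\mathcal T}^i\cap\mathcal N_{\mathcal S}$ has exactly one element for every $i\in\mathcal T$. (b) All $u_n^i$ are strongly concave and all $c_n^i$ are strongly convex. (c) All edge-wise sums of prices are positive: $\lambda_n+\lambda_m>0$ for all $\{n,m\}\in\mathcal E$; prices satisfy this at each iteration of the pricing process. (d) Agents are price-taking: they assume that the price remains unchanged if they change their response. (e) Problem (P) is feasible. **Angle constraints.** $\boldsymbol\Theta^i$ is the set of $\boldsymbol\theta^i$ with $g(\theta_{nm})\le K_{nm}$, $g(\theta_{mn})\le K_{mn}$ and $\underline\theta_{nm}\le\theta_{nm}\le\bar\theta_{nm}$ for $\{n,m\}\in\mathcal E^i$; $\theta_n=0$ for $n\in\mathcal N_{\mathcal T}^i\cap\mathcal N_{\mathcal S}$; and $\theta_n\in[-\pi,\pi]$ for $n\in\mathcal N_{\mathcal T}^i$. $\boldsymbol\Theta$ is the set of $(\boldsymbol\theta^1,\dots,\boldsymbol\theta^T)\in\boldsymbol\Theta^1\times\dots\times\boldsymbol\Theta^T$, $T=|\mathcal T|$, with $\theta_n^i=\theta_n^j$ for all $n\in\mathcal N_{\mathcal T}^i\cap\mathcal N_{\mathcal T}^j$, $i,j\in\mathcal T$ (identified with the common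 angle profile $\boldsymbol\theta$). **Problem (P).** With $\mathbf x=(\{\mathbf e^i\}_{i\in\mathcal D},\{\mathbf p^i\}_{i\in\mathcal G},\boldsymbol\theta)$ and $\mathbf X$ the set of $\mathbf x$ with $\mathbf e^i\in\mathbf E^i$ for all $i\in\mathcal D$, $\mathbf p^i\in\mathbf P^i$ for all $i\in\mathcal G$ and $\boldsymbol\theta\in\boldsymbol\Theta$, $$\max_{\mathbf x\in\mathbf X}\ J(\mathbf x):=\sum_{i\in\mathcal D}\mathbf u^i(\mathbf e^i)-\sum_{i\in\mathcal G}\mathbf c^i(\mathbf p^i)\quad\text{s.t.}\quad\mathbf h(\mathbf x):=\mathbf f(\boldsymbol\theta)-\mathbf p+\mathbf e+\mathbf s=\mathbf 0.$$ For a vector $\boldsymbol\lambda=(\lambda_n)_{n\in\mathcal N}$ of locational marginal prices, the Lagrangian is $\mathcal L(\mathbf x,\boldsymbol\lambda)=J(\mathbf x)-\boldsymbol\lambda^\top\mathbf h(\mathbf x)$ and the dual function is $\phi(\boldsymbol\lambda)=\max_{\mathbf x\in\mathbf X}\mathcal L(\mathbf x,\boldsymbol\lambda)$. **Surpluses.** $$\Psi_{\mathcal D}^i(\mathbf e^i,\boldsymbol\lambda)=\sum_{n\in\mathcal N_{\mathcal D^e}^i}[u_n^i(e_n^i)-\lambda_ne_n^i]-\sum_{n\in\mathcal N_{\mathcal D^s}^i}\lambda_ns_n^i,\qquad\Psi_{\mathcal G}^i(\mathbf p^i,\boldsymbol\lambda)=\sum_{n\in\mathcal N_{\mathcal G}^i}[\lambda_np_n^i-c_n^i(p_n^i)].$$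 The merchandizing surplus of TransCo $i$, with $\vec{\mathcal E}^i$ containing both $(n,m)$ and $(m,n)$ for each $\{n,m\}\in\mathcal E^i$, is $$\Psi_{\mathcal T}^i(\boldsymbol\theta^i,\boldsymbol\lambda)=\tfrac12\sum_{(n,m)\in\vec{\mathcal E}^i}\Big((\lambda_m-\lambda_n)B_{nm}(\theta_n-\theta_m)-(\lambda_n+\lambda_m)\tfrac12G_{nm}(\theta_n-\theta_m)^2\Big),$$ and the total merchandizing surplus is $\Psi_{\mathcal T}(\boldsymbol\theta,\boldsymbol\lambda)=\sum_{i\in\mathcal T}\Psi_{\mathcal T}^i(\boldsymbol\theta^i,\boldsymbol\lambda)=-\sum_{n\in\mathcal N}\lambda_nf_n(\boldsymbol\theta)$. **Price response.** Given $\boldsymbol\lambda$, $\mathbf e^i(\boldsymbol\lambda)$ is the unique maximizer of $\Psi_{\mathcal D}^i(\cdot,\boldsymbol\lambda)$ over $\mathbf E^i$, $\mathbf p^i(\boldsymbol\lambda)$ is the unique maximizer of $\Psi_{\mathcal G}^i(\cdot,\boldsymbol\lambda)$ over $\mathbf P^i$, and $\boldsymbol\theta(\boldsymbol\lambda)$ is the unique maximizer of the total merchandizing surplus $\Psi_{\mathcal T}(\cdot,\boldsymbol\lambda)$ over $\boldsymbol\Theta$, reached by the TransCos through an iterative message exchange (ADMM) in which neighboring TransCos exchange the angle values of their shared buses. **Pricing process.** Starting from an initial price vector $\boldsymbol\lambda^0$, at each iteration $t$ the market operator collects the responses $\mathbf x(\boldsymbol\lambda^t)$ and performs the gradient descent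 step on the dual function $$\boldsymbol\lambda^{t+1}=\boldsymbol\lambda^t-\alpha_t\nabla\phi(\boldsymbol\lambda^t)=\boldsymbol\lambda^t+\alpha_t\,\mathbf h(\mathbf x(\boldsymbol\lambda^t)),$$ with step sizes $\alpha_t$ such that $\sum_t\alpha_t^2<\infty$ and $\sum_t\alpha_t=\infty$ (for instance $\alpha_t=\beta/t$ with $\beta>0$). **Competitive equilibrium.** A tuple $(\{\hat{\mathbf e}^i\}_{i\in\mathcal D},\{\hat{\mathbf p}^i\}_{i\in\mathcal G},\hat{\boldsymbol\theta},\hat{\boldsymbol\lambda})$ such that (i) $\|f_n(\hat{\boldsymbol\theta})-\hat p_n+\hat e_n+s_n\|<\varepsilon$ for all $n\in\mathcal N$, $\varepsilon>0$; (ii) $\hat{\mathbf e}^i(\hat{\boldsymbol\lambda})$ maximizes $\Psi_{\mathcal D}^i(\mathbf e^i,\hat{\boldsymbol\lambda})$ subject to $\mathbf e^i\in\mathbf E^i$, for all $i\in\mathcal D$; $\hat{\mathbf p}^i(\hat{\boldsymbol\lambda})$ maximizes $\Psi_{\mathcal G}^i(\mathbf p^i,\hat{\boldsymbol\lambda})$ subject to $\mathbf p^i\in\mathbf P^i$, for all $i\in\mathcal G$; and $\hat{\boldsymbol\theta}^i(\hat{\boldsymbol\lambda})$ maximizes $\Psi_{\mathcal T}^i(\boldsymbol\theta^i,\hat{\boldsymbol\lambda})$ subject to $\boldsymbol\theta^i\in\boldsymbol\Theta^i$, for all $i\in\mathcal T$.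
   Formalization: Added: the dual function attains its minimum (else prices may diverge). In equilibrium (ii), each TransCo maximizes its surplus subject to agreement with its neighbours at shared buses, and the total surplus is jointly maximal; individual maximization over all of Θ^i can fail. *)

theory Defs
  imports "HOL-Analysis.Analysis"
begin

text \<open>
  Buses are the elements of a finite type \<open>'n\<close>; distribution, generation and transmission
  companies form finite (possibly empty) sets. A line is a two-element set of buses. Line data are
  given on ordered pairs of buses. A vector indexed by a set \<open>A\<close> of buses is a function that is
  extensional on \<open>A\<close>.
\<close>

record ('n, 'd, 'g, 't) market =
  edges :: "'n set set"
  line_limit :: "'n \<Rightarrow> 'n \<Rightarrow> real"
  conductance :: "'n \<Rightarrow> 'n \<Rightarrow> real"
  susceptance :: "'n \<Rightarrow> 'n \<Rightarrow> real"
  angle_lo :: "'n \<Rightarrow> 'n \<Rightarrow> real"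
  angle_hi :: "'n \<Rightarrow> 'n \<Rightarrow> real"
  slack_buses :: "'n set"
  distcos :: "'d set"
  elastic_buses :: "'d \<Rightarrow> 'n set"
  load_lo :: "'d \<Rightarrow> 'n \<Rightarrow> real"
  load_hi :: "'d \<Rightarrow> 'n \<Rightarrow> real"
  utility :: "'d \<Rightarrow> 'n \<Rightarrow> real \<Rightarrow> real"
  inelastic_buses :: "'d \<Rightarrow> 'n set"
  inelastic_load :: "'d \<Rightarrow> 'n \<Rightarrow> real"
  gencos :: "'g set"
  gen_buses :: "'g \<Rightarrow> 'n set"
  gen_lo :: "'g \<Rightarrow> 'n \<Rightarrow> real"
  gen_hi :: "'g \<Rightarrow> 'n \<Rightarrow> real"
  gen_cost :: "'g \<Rightarrow> 'n \<Rightarrow> real \<Rightarrow> real"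
  transcos :: "'t set"
  owned_lines :: "'t \<Rightarrow> 'n set set"

definition strongly_convex_on :: "real set \<Rightarrow> (real \<Rightarrow> real) \<Rightarrow> bool" where
  "strongly_convex_on S f \<longleftrightarrow>
     (\<exists>k>0. \<forall>x\<in>S. \<forall>y\<in>S. \<forall>t\<in>{0..1}.
        f (t * x + (1 - t) * y) \<le> t * f x + (1 - t) * f y - k / 2 * t * (1 - t) * (x - y)\<^sup>2)"

definition strongly_concave_on :: "real set \<Rightarrow> (real \<Rightarrow> real) \<Rightarrow> bool" where
  "strongly_concave_on S f \<longleftrightarrow> strongly_convex_on S (\<lambda>x. - f x)"

definition transco_buses :: "('n, 'd, 'g, 't) market \<Rightarrow> 't \<Rightarrow> 'n set" where
  "transco_buses M i = \<Union> (owned_lines M i)"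

definition energy_market :: "('n, 'd, 'g, 't) market \<Rightarrow> bool" where
  "energy_market M \<longleftrightarrow>
     (\<forall>l\<in>edges M. \<exists>n m. n \<noteq> m \<and> l = {n, m}) \<and>
     (\<forall>n m. {n, m} \<in> edges M \<longrightarrow>
        line_limit M n m > 0 \<and> conductance M n m > 0 \<and> susceptance M n m > 0) \<and>
     (\<forall>n m. {n, m} \<notin> edges M \<longrightarrow>
        line_limit M n m = 0 \<and> conductance M n m = 0 \<and> susceptance M n m = 0) \<and>
     (\<forall>n m. line_limit M n m = line_limit M m n \<and> conductance M n m = conductance M m n
        \<and> susceptance M n m = susceptance M m n) \<and>
     finite (distcos M) \<and> finite (gencos M) \<and> finite (transcos M) \<and>
     (\<forall>i\<in>distcos M. \<forall>n\<in>elastic_buses M i.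
        strongly_concave_on {load_lo M i n..load_hi M i n} (utility M i n)) \<and>
     (\<forall>i\<in>distcos M. \<forall>n\<in>inelastic_buses M i. inelastic_load M i n \<ge> 0) \<and>
     (\<forall>i\<in>gencos M. \<forall>n\<in>gen_buses M i.
        strongly_convex_on {gen_lo M i n..gen_hi M i n} (gen_cost M i n)) \<and>
     disjoint_family_on (owned_lines M) (transcos M) \<and>
     (\<Union>i\<in>transcos M. owned_lines M i) = edges M \<and>
     (\<forall>i\<in>transcos M. \<exists>!n. n \<in> transco_buses M i \<inter> slack_buses M)"

definition flow :: "('n, 'd, 'g, 't) market \<Rightarrow> ('n \<Rightarrow> real) \<Rightarrow> 'n \<Rightarrow> 'n \<Rightarrow> real" where
  "flow M \<theta> n m = susceptance M n m * (\<theta> n - \<theta> m) + 1 / 2 * conductance M n m * (\<theta> n - \<theta> m)\<^sup>2"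

definition injection :: "('n::finite, 'd, 'g, 't) market \<Rightarrow> ('n \<Rightarrow> real) \<Rightarrow> 'n \<Rightarrow> real" where
  "injection M \<theta> n = (\<Sum>m\<in>UNIV. flow M \<theta> n m)"

definition load_set :: "('n, 'd, 'g, 't) market \<Rightarrow> 'd \<Rightarrow> ('n \<Rightarrow> real) set" where
  "load_set M i = (\<Pi>\<^sub>E n\<in>elastic_buses M i. {load_lo M i n..load_hi M i n})"

definition gen_set :: "('n, 'd, 'g, 't) market \<Rightarrow> 'g \<Rightarrow> ('n \<Rightarrow> real) set" where
  "gen_set M i = (\<Pi>\<^sub>E n\<in>gen_buses M i. {gen_lo M i n..gen_hi M i n})"

text \<open>
  Both orientations of each owned line are constrained. Bounds given for one orientation only are
  the case \<open>angle_lo M m n = - angle_hi M n m\<close>.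
\<close>

definition transco_angle_set :: "('n, 'd, 'g, 't) market \<Rightarrow> 't \<Rightarrow> ('n \<Rightarrow> real) set" where
  "transco_angle_set M i =
     {\<theta> \<in> extensional (transco_buses M i).
        (\<forall>n m. {n, m} \<in> owned_lines M i \<longrightarrow>
           flow M \<theta> n m \<le> line_limit M n m \<and>
           angle_lo M n m \<le> \<theta> n - \<theta> m \<and> \<theta> n - \<theta> m \<le> angle_hi M n m) \<and>
        (\<forall>n\<in>transco_buses M i \<inter> slack_buses M. \<theta> n = 0) \<and>
        (\<forall>n\<in>transco_buses M i. \<theta> n \<in> {-pi..pi})}"

text \<open>
  A tuple of angle vectors, one per transmission company, that agree on shared buses is the same as
  a common angle profile on the union of their bus sets.
\<close>

definition angle_set :: "('n, 'd, 'g, 't) market \<Rightarrow> ('n \<Rightarrow> real) set" where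
  "angle_set M =
     {\<theta> \<in> extensional (\<Union>i\<in>transcos M. transco_buses M i).
        \<forall>i\<in>transcos M. restrict \<theta> (transco_buses M i) \<in> transco_angle_set M i}"

type_synonym ('n, 'd, 'g) dispatch = "('d \<Rightarrow> 'n \<Rightarrow> real) \<times> ('g \<Rightarrow> 'n \<Rightarrow> real) \<times> ('n \<Rightarrow> real)"

definition dispatch_set :: "('n, 'd, 'g, 't) market \<Rightarrow> ('n, 'd, 'g) dispatch set" where
  "dispatch_set M =
     {(e, p, \<theta>). (\<forall>i\<in>distcos M. e i \<in> load_set M i) \<and> (\<forall>i\<in>gencos M. p i \<in> gen_set M i) \<and>
        \<theta> \<in> angle_set M}"

definition net_gen :: "('n, 'd, 'g, 't) market \<Rightarrow> ('g \<Rightarrow> 'n \<Rightarrow> real) \<Rightarrow> 'n \<Rightarrow> real" where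
  "net_gen M p n = (\<Sum>i\<in>{i\<in>gencos M. n \<in> gen_buses M i}. p i n)"

definition net_elastic :: "('n, 'd, 'g, 't) market \<Rightarrow> ('d \<Rightarrow> 'n \<Rightarrow> real) \<Rightarrow> 'n \<Rightarrow> real" where
  "net_elastic M e n = (\<Sum>i\<in>{i\<in>distcos M. n \<in> elastic_buses M i}. e i n)"

definition net_inelastic :: "('n, 'd, 'g, 't) market \<Rightarrow> 'n \<Rightarrow> real" where
  "net_inelastic M n = (\<Sum>i\<in>{i\<in>distcos M. n \<in> inelastic_buses M i}. inelastic_load M i n)"

definition imbalance :: "('n::finite, 'd, 'g, 't) market \<Rightarrow> ('n, 'd, 'g) dispatch \<Rightarrow> real ^ 'n" where
  "imbalance M = (\<lambda>(e, p, \<theta>).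
     \<chi> n. injection M \<theta> n - net_gen M p n + net_elastic M e n + net_inelastic M n)"

definition welfare :: "('n, 'd, 'g, 't) market \<Rightarrow> ('n, 'd, 'g) dispatch \<Rightarrow> real" where
  "welfare M = (\<lambda>(e, p, \<theta>).
     (\<Sum>i\<in>distcos M. \<Sum>n\<in>elastic_buses M i. utility M i n (e i n))
     - (\<Sum>i\<in>gencos M. \<Sum>n\<in>gen_buses M i. gen_cost M i n (p i n)))"

definition feasible_set :: "('n::finite, 'd, 'g, 't) market \<Rightarrow> ('n, 'd, 'g) dispatch set" where
  "feasible_set M = {x \<in> dispatch_set M. imbalance M x = 0}"

definition welfare_optimal :: "('n::finite, 'd, 'g, 't) market \<Rightarrow> ('n, 'd, 'g) dispatch \<Rightarrow> bool" where
  "welfare_optimal M x \<longleftrightarrow> is_arg_max (welfare M) (\<lambda>y. y \<in> feasible_set M) x"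

definition lagrangian ::
  "('n::finite, 'd, 'g, 't) market \<Rightarrow> ('n, 'd, 'g) dispatch \<Rightarrow> real ^ 'n \<Rightarrow> real" where
  "lagrangian M x lam = welfare M x - lam \<bullet> imbalance M x"

definition dual_function :: "('n::finite, 'd, 'g, 't) market \<Rightarrow> real ^ 'n \<Rightarrow> real" where
  "dual_function M lam = (SUP x\<in>dispatch_set M. lagrangian M x lam)"

definition distco_surplus ::
  "('n::finite, 'd, 'g, 't) market \<Rightarrow> 'd \<Rightarrow> ('n \<Rightarrow> real) \<Rightarrow> real ^ 'n \<Rightarrow> real" where
  "distco_surplus M i e lam =
     (\<Sum>n\<in>elastic_buses M i. utility M i n (e n) - lam $ n * e n)
     - (\<Sum>n\<in>inelastic_buses M i. lam $ n * inelastic_load M i n)"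

definition genco_surplus ::
  "('n::finite, 'd, 'g, 't) market \<Rightarrow> 'g \<Rightarrow> ('n \<Rightarrow> real) \<Rightarrow> real ^ 'n \<Rightarrow> real" where
  "genco_surplus M i p lam = (\<Sum>n\<in>gen_buses M i. lam $ n * p n - gen_cost M i n (p n))"

definition transco_surplus ::
  "('n::finite, 'd, 'g, 't) market \<Rightarrow> 't \<Rightarrow> ('n \<Rightarrow> real) \<Rightarrow> real ^ 'n \<Rightarrow> real" where
  "transco_surplus M i \<theta> lam =
     1 / 2 * (\<Sum>(n, m)\<in>{(n, m). {n, m} \<in> owned_lines M i}.
       (lam $ m - lam $ n) * susceptance M n m * (\<theta> n - \<theta> m)
       - (lam $ n + lam $ m) * (1 / 2 * conductance M n m * (\<theta> n - \<theta> m)\<^sup>2))"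

definition total_transco_surplus ::
  "('n::finite, 'd, 'g, 't) market \<Rightarrow> ('n \<Rightarrow> real) \<Rightarrow> real ^ 'n \<Rightarrow> real" where
  "total_transco_surplus M \<theta> lam =
     (\<Sum>i\<in>transcos M. transco_surplus M i (restrict \<theta> (transco_buses M i)) lam)"

text \<open>
  The joint response of the transmission companies maximizes their total surplus. With positive
  edge-wise price sums its angle differences along lines, hence the injections, are unique; the
  angles themselves are unique once every line is connected to a slack bus.
\<close>

definition price_response ::
  "('n::finite, 'd, 'g, 't) market \<Rightarrow> real ^ 'n \<Rightarrow> ('n, 'd, 'g) dispatch \<Rightarrow> bool" where
  "price_response M lam = (\<lambda>(e, p, \<theta>).
     (\<forall>i\<in>distcos M. is_arg_max (\<lambda>y. distco_surplus M i y lam) (\<lambda>y. y \<in> load_set M i) (e i)) \<and>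
     (\<forall>i\<in>gencos M. is_arg_max (\<lambda>y. genco_surplus M i y lam) (\<lambda>y. y \<in> gen_set M i) (p i)) \<and>
     is_arg_max (\<lambda>y. total_transco_surplus M y lam) (\<lambda>y. y \<in> angle_set M) \<theta>)"

definition edge_positive :: "('n::finite, 'd, 'g, 't) market \<Rightarrow> real ^ 'n \<Rightarrow> bool" where
  "edge_positive M lam \<longleftrightarrow> (\<forall>n m. {n, m} \<in> edges M \<longrightarrow> lam $ n + lam $ m > 0)"

text \<open>The update is \<open>- \<alpha> t\<close> times the gradient of the dual function, which is minus the imbalance.\<close>

definition pricing_process ::
  "('n::finite, 'd, 'g, 't) market \<Rightarrow> (real ^ 'n \<Rightarrow> ('n, 'd, 'g) dispatch) \<Rightarrow> (nat \<Rightarrow> real) \<Rightarrow>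
     (nat \<Rightarrow> real ^ 'n) \<Rightarrow> bool" where
  "pricing_process M x \<alpha> lam \<longleftrightarrow> (\<forall>t. lam (Suc t) = lam t + \<alpha> t *\<^sub>R imbalance M (x (lam t)))"

definition step_sizes :: "(nat \<Rightarrow> real) \<Rightarrow> bool" where
  "step_sizes \<alpha> \<longleftrightarrow>
     (\<forall>t. \<alpha> t \<ge> 0) \<and> summable (\<lambda>t. (\<alpha> t)\<^sup>2) \<and> filterlim (\<lambda>k. \<Sum>t<k. \<alpha> t) at_top sequentially"

definition shared_buses :: "('n, 'd, 'g, 't) market \<Rightarrow> 't \<Rightarrow> 'n set" where
  "shared_buses M i = transco_buses M i \<inter> (\<Union>j\<in>transcos M - {i}. transco_buses M j)"

text \<open>
  A profile \<open>\<theta>\<close> assigns one angle to each shared bus, so the choice of a single transmission company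
  is subject to consensus with the angles of its neighbours; where all shared buses are slack buses
  this adds nothing to membership in \<open>transco_angle_set M i\<close>. Besides the individual
  optimality, the angles are required to be jointly optimal, as in \<^const>\<open>price_response\<close>.
\<close>

definition competitive_equilibrium ::
  "('n::finite, 'd, 'g, 't) market \<Rightarrow> real \<Rightarrow> ('n, 'd, 'g) dispatch \<Rightarrow> real ^ 'n \<Rightarrow> bool" where
  "competitive_equilibrium M \<epsilon> = (\<lambda>(e, p, \<theta>) lam.
     (\<forall>n. norm (injection M \<theta> n - net_gen M p n + net_elastic M e n + net_inelastic M n) < \<epsilon>) \<and>
     (\<forall>i\<in>distcos M. is_arg_max (\<lambda>y. distco_surplus M i y lam) (\<lambda>y. y \<in> load_set M i) (e i)) \<and>
     (\<forall>i\<in>gencos M. is_arg_max (\<lambda>y. genco_surplus M i y lam) (\<lambda>y. y \<in> gen_set M i) (p i)) \<and>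
     (\<forall>i\<in>transcos M. is_arg_max (\<lambda>y. transco_surplus M i y lam)
        (\<lambda>y. y \<in> transco_angle_set M i \<and> (\<forall>n\<in>shared_buses M i. y n = \<theta> n))
        (restrict \<theta> (transco_buses M i))) \<and>
     is_arg_max (\<lambda>y. total_transco_surplus M y lam) (\<lambda>y. y \<in> angle_set M) \<theta>)"

end

theory Submission
  imports Defs
begin

text \<open>
  The pricing process is subgradient descent on the dual function \<open>\<phi>\<close>: a dispatch \<open>x(\<lambda>)\<close> that
  responds optimally to \<open>\<lambda>\<close> maximizes the Lagrangian, which is affine in the prices, so minus
  its imbalance is a subgradient of \<open>\<phi>\<close> at \<open>\<lambda>\<close>. Imbalances are bounded and \<open>\<phi>\<close> attains its
  minimum, so square-summable step sizes with infinite sum drive the prices to a minimizer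
  (\<open>square_summable_subgradient_descent_converges\<close>).

  It remains to see that markets clear at the limit. The Lagrangian is the sum of the agents'
  surpluses (\<open>lagrangian_eq_total_surplus\<close>), which are strongly concave in loads, in generation
  and, when the edge-wise price sums are positive, in the angle differences along lines. The
  imbalance is a Lipschitz function of these quantities, so an optimal response \<open>x\<close> satisfies
  \<open>\<bar>h(y) - h(x)\<bar>\<^sup>2 \<le> C (L(x) - L(y))\<close> for all dispatches \<open>y\<close> (\<open>lagrangian_quadratic_growth\<close>).
  Although the injections \<open>f\<close> are nonlinear in the angles, this makes \<open>- h(x)\<close> the gradient of
  \<open>\<phi>\<close>, and the gradient vanishes at a minimizer (\<open>response_at_dual_minimizer_balances\<close>). So
  there is no duality gap: the response at the limit is feasible, and a feasible maximizer of
  the Lagrangian maximizes welfare. Optimality of each transmission company on its own, given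
  the angles of the shared buses, follows from joint optimality
  (\<open>joint_optimum_individually_optimal\<close>).
\<close>

section \<open>Subgradient descent with square-summable steps\<close>

text \<open>
  The subgradient inequality gives, for every minimizer \<open>\<mu>\<close>,
  \<open>\<bar>lam (t+1) - \<mu>\<bar>\<^sup>2 \<le> \<bar>lam t - \<mu>\<bar>\<^sup>2 - 2 \<alpha> t (\<phi> (lam t) - \<phi> \<mu>) + G\<^sup>2 (\<alpha> t)\<^sup>2\<close>. Since the last
  terms are summable, the distance to each minimizer converges. Since the steps have infinite
  sum, the values come arbitrarily close to the minimum infinitely often, so by compactness some
  cluster point is itself a minimizer. The distance to that particular minimizer converges and
  vanishes along a subsequence, hence it tends to zero.
\<close>

lemma square_summable_subgradient_descent_converges:
  fixes lam g :: "nat \<Rightarrow> 'a::euclidean_space" and \<phi> :: "'a \<Rightarrow> real"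
  assumes step: "\<And>t. lam (Suc t) = lam t - \<alpha> t *\<^sub>R g t"
    and subgradient: "\<And>t \<nu>. \<phi> (lam t) + g t \<bullet> (\<nu> - lam t) \<le> \<phi> \<nu>"
    and g_bound: "\<And>t. norm (g t) \<le> G"
    and cont: "continuous_on UNIV \<phi>"
    and attained: "\<exists>\<mu>. \<forall>\<nu>. \<phi> \<mu> \<le> \<phi> \<nu>"
    and nonneg: "\<And>t. \<alpha> t \<ge> 0"
    and sq_summable: "summable (\<lambda>t. (\<alpha> t)\<^sup>2)"
    and diverges: "filterlim (\<lambda>k. \<Sum>t<k. \<alpha> t) at_top sequentially"
  shows "\<exists>l. lam \<longlonglongrightarrow> l \<and> (\<forall>\<nu>. \<phi> l \<le> \<phi> \<nu>)"
proof -
  define V where "V = (\<Sum>t. G\<^sup>2 * (\<alpha> t)\<^sup>2)"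
  define a where "a \<mu> t = (norm (lam t - \<mu>))\<^sup>2 - (\<Sum>s<t. G\<^sup>2 * (\<alpha> s)\<^sup>2)" for \<mu> t
  have summ: "summable (\<lambda>t. G\<^sup>2 * (\<alpha> t)\<^sup>2)"
    using sq_summable by (rule summable_mult)
  have partial_le: "(\<Sum>s<t. G\<^sup>2 * (\<alpha> s)\<^sup>2) \<le> V" for t
    unfolding V_def by (rule sum_le_suminf[OF summ]) auto
  have a_lower: "- V \<le> a \<mu> t" for \<mu> t
    using partial_le[of t] zero_le_power2[of "norm (lam t - \<mu>)"] unfolding a_def by linarith
  \<comment> \<open>Subtracting the accumulated error terms makes the squared distance to a minimizer monotone.\<close>
  have a_step: "a \<mu> (Suc t) \<le> a \<mu> t - 2 * \<alpha> t * (\<phi> (lam t) - \<phi> \<mu>)" for \<mu> t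
  proof -
    have "(norm (lam (Suc t) - \<mu>))\<^sup>2
        = (norm (lam t - \<mu>))\<^sup>2 - 2 * \<alpha> t * (g t \<bullet> (lam t - \<mu>)) + (\<alpha> t)\<^sup>2 * (norm (g t))\<^sup>2"
      unfolding step power2_norm_eq_inner
      by (simp add: inner_diff_left inner_diff_right inner_commute power2_eq_square algebra_simps)
    moreover have "\<alpha> t * (\<phi> (lam t) - \<phi> \<mu>) \<le> \<alpha> t * (g t \<bullet> (lam t - \<mu>))"
      using subgradient[of t \<mu>] nonneg[of t]
      by (intro mult_left_mono) (auto simp: inner_diff_right)
    moreover have "(\<alpha> t)\<^sup>2 * (norm (g t))\<^sup>2 \<le> G\<^sup>2 * (\<alpha> t)\<^sup>2"
      using g_bound[of t] by (subst mult.commute) (intro mult_right_mono power_mono, auto)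
    ultimately show ?thesis unfolding a_def by simp
  qed
  have dist_convergent: "convergent (\<lambda>t. (norm (lam t - \<mu>))\<^sup>2)" if "\<forall>\<nu>. \<phi> \<mu> \<le> \<phi> \<nu>" for \<mu>
  proof -
    have "a \<mu> (Suc t) \<le> a \<mu> t" for t
    proof -
      have "0 \<le> 2 * \<alpha> t * (\<phi> (lam t) - \<phi> \<mu>)"
        using that nonneg[of t] by simp
      then show ?thesis using a_step[of \<mu> t] by linarith
    qed
    then have "decseq (a \<mu>)" by (rule decseq_SucI)
    then obtain L where "a \<mu> \<longlonglongrightarrow> L"
      using decseq_convergent[of "a \<mu>" "- V"] a_lower by blast
    moreover have "(\<lambda>t. \<Sum>s<t. G\<^sup>2 * (\<alpha> s)\<^sup>2) \<longlonglongrightarrow> V"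
      unfolding V_def using summ by (rule summable_LIMSEQ)
    ultimately have "(\<lambda>t. a \<mu> t + (\<Sum>s<t. G\<^sup>2 * (\<alpha> s)\<^sup>2)) \<longlonglongrightarrow> L + V"
      by (rule tendsto_add)
    then show ?thesis unfolding a_def convergent_def by auto
  qed
  obtain \<mu> where \<mu>: "\<forall>\<nu>. \<phi> \<mu> \<le> \<phi> \<nu>" using attained by blast
  have near_optimal: "\<exists>t\<ge>T. \<phi> (lam t) < \<phi> \<mu> + \<epsilon>" if "\<epsilon> > 0" for \<epsilon> T
  proof (rule ccontr)
    assume "\<not> ?thesis"
    then have far: "\<epsilon> \<le> \<phi> (lam t) - \<phi> \<mu>" if "t \<ge> T" for t
      using that by (force simp: not_less)
    define b where "b t = a \<mu> t + 2 * \<epsilon> * (\<Sum>s<t. \<alpha> s)" for t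
    \<comment> \<open>A permanent excess of \<open>\<epsilon>\<close> over the minimum would bound the partial sums of the steps.\<close>
    have "b (T + j) \<le> b T" for j
    proof (induction j)
      case (Suc j)
      have "\<epsilon> * \<alpha> (T + j) \<le> \<alpha> (T + j) * (\<phi> (lam (T + j)) - \<phi> \<mu>)"
        using far[of "T + j"] nonneg[of "T + j"] by (subst mult.commute) (intro mult_left_mono, auto)
      then show ?case
        using Suc a_step[of \<mu> "T + j"] unfolding b_def by (simp add: algebra_simps)
    qed simp
    then have "2 * \<epsilon> * (\<Sum>s<T + j. \<alpha> s) \<le> b T + V" for j
      using a_lower[of \<mu> "T + j"] unfolding b_def by (smt (verit))
    then have bounded_sum: "(\<Sum>s<T + j. \<alpha> s) \<le> (b T + V) / (2 * \<epsilon>)" for j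
      using that by (subst pos_le_divide_eq) (simp_all add: mult_ac)
    have "eventually (\<lambda>k. (b T + V) / (2 * \<epsilon>) + 1 \<le> (\<Sum>s<k. \<alpha> s)) sequentially"
      using diverges unfolding filterlim_at_top by blast
    then obtain k where "\<And>k'. k' \<ge> k \<Longrightarrow> (b T + V) / (2 * \<epsilon>) + 1 \<le> (\<Sum>s<k'. \<alpha> s)"
      unfolding eventually_sequentially by blast
    from this[of "T + k"] bounded_sum[of k] show False by simp
  qed
  have "\<forall>k. \<exists>t\<ge>k. \<phi> (lam t) < \<phi> \<mu> + 1 / real (Suc k)"
    using near_optimal by simp
  then obtain r where r: "\<And>k. r k \<ge> k" "\<And>k. \<phi> (lam (r k)) < \<phi> \<mu> + 1 / real (Suc k)"
    by metis
  have "Bseq (\<lambda>t. (norm (lam t - \<mu>))\<^sup>2)"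
    using dist_convergent[OF \<mu>] by (rule convergent_imp_Bseq)
  then obtain B where B: "\<And>t. norm ((norm (lam t - \<mu>))\<^sup>2) \<le> B"
    unfolding Bseq_def by blast
  have "norm (lam t) \<le> norm \<mu> + (B + 1)" for t
  proof -
    \<comment> \<open>Here \<open>B\<close> bounds the square of the norm, and \<open>d \<le> d\<^sup>2 + 1\<close>.\<close>
    have "norm (lam t - \<mu>) \<le> B + 1"
      using B[of t] zero_le_power2[of "norm (lam t - \<mu>) - 1"] norm_ge_zero[of "lam t - \<mu>"]
      by (simp only: power2_diff real_norm_def power_one mult_1_right)
    then show ?thesis using norm_triangle_ineq2[of "lam t" \<mu>] by linarith
  qed
  then have "bounded (range (lam \<circ> r))"
    unfolding bounded_iff by auto
  then obtain l s where s: "strict_mono s" "((lam \<circ> r) \<circ> s) \<longlonglongrightarrow> l"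
    using bounded_imp_convergent_subsequence by blast
  \<comment> \<open>The indices \<open>r k\<close> need not increase, but they tend to infinity because \<open>r k \<ge> k\<close>.\<close>
  have "k \<le> r (s k)" for k
    using r(1)[of "s k"] seq_suble[OF s(1), of k] by linarith
  then have rs: "filterlim (\<lambda>k. r (s k)) at_top sequentially"
    by (intro filterlim_at_top_mono[OF filterlim_ident] always_eventually) simp
  have limit: "(\<lambda>k. lam (r (s k))) \<longlonglongrightarrow> l"
    using s(2) by (simp add: o_def)
  have "isCont \<phi> l"
    using cont by (simp add: continuous_on_eq_continuous_at)
  then have "(\<lambda>k. \<phi> (lam (r (s k)))) \<longlonglongrightarrow> \<phi> l"
    using limit by (rule isCont_tendsto_compose)
  moreover have "(\<lambda>k. \<phi> \<mu> + 1 / real (Suc (s k))) \<longlonglongrightarrow> \<phi> \<mu> + 0"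
    using LIMSEQ_subseq_LIMSEQ[OF LIMSEQ_Suc[OF lim_1_over_n] s(1)]
    by (intro tendsto_add tendsto_const) (simp add: o_def)
  ultimately have "\<phi> l \<le> \<phi> \<mu> + 0"
    by (rule LIMSEQ_le) (use r(2) less_imp_le in blast)
  with \<mu> have l_min: "\<forall>\<nu>. \<phi> l \<le> \<phi> \<nu>" by (metis add.right_neutral order_trans)
  obtain D where D: "(\<lambda>t. (norm (lam t - l))\<^sup>2) \<longlonglongrightarrow> D"
    using dist_convergent[OF l_min] unfolding convergent_def by blast
  have "(\<lambda>k. (norm (lam (r (s k)) - l))\<^sup>2) \<longlonglongrightarrow> D"
    using filterlim_compose[OF D rs] .
  moreover have "(\<lambda>k. (norm (lam (r (s k)) - l))\<^sup>2) \<longlonglongrightarrow> (norm (l - l))\<^sup>2"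
    by (intro tendsto_intros limit)
  ultimately have "D = (norm (l - l))\<^sup>2" by (rule LIMSEQ_unique)
  then have "D = 0" by simp
  with D have "(\<lambda>t. (norm (lam t - l))\<^sup>2) \<longlonglongrightarrow> 0" by (simp only:)
  then have "(\<lambda>t. sqrt ((norm (lam t - l))\<^sup>2)) \<longlonglongrightarrow> sqrt 0"
    by (rule tendsto_real_sqrt)
  then have "(\<lambda>t. norm (lam t - l)) \<longlonglongrightarrow> 0" by simp
  then have "lam \<longlonglongrightarrow> l"
    by (rule Lim_null[THEN iffD2, OF tendsto_norm_zero_cancel])
  with l_min show ?thesis by blast
qed

section \<open>The Lagrangian as a sum of surpluses\<close>

lemma
  assumes M: "energy_market M"
  shows line_data_pos: "{n, m} \<in> edges M \<Longrightarrow> conductance M n m > 0 \<and> susceptance M n m > 0"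
    and line_data_zero: "{n, m} \<notin> edges M \<Longrightarrow> susceptance M n m = 0 \<and> conductance M n m = 0"
    and line_data_sym: "susceptance M n m = susceptance M m n" "conductance M n m = conductance M m n"
    and finite_agents: "finite (distcos M)" "finite (gencos M)" "finite (transcos M)"
    and owned_lines_disjoint: "disjoint_family_on (owned_lines M) (transcos M)"
    and owned_lines_Union: "(\<Union>i\<in>transcos M. owned_lines M i) = edges M"
proof -
  have "\<forall>n m. {n, m} \<in> edges M \<longrightarrow>
        line_limit M n m > 0 \<and> conductance M n m > 0 \<and> susceptance M n m > 0"
    using M unfolding energy_market_def by (elim conjE)
  then show "{n, m} \<in> edges M \<Longrightarrow> conductance M n m > 0 \<and> susceptance M n m > 0" by simp
  have "\<forall>n m. {n, m} \<notin> edges M \<longrightarrow>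
        line_limit M n m = 0 \<and> conductance M n m = 0 \<and> susceptance M n m = 0"
    using M unfolding energy_market_def by (elim conjE)
  then show "{n, m} \<notin> edges M \<Longrightarrow> susceptance M n m = 0 \<and> conductance M n m = 0" by simp
  have "\<forall>n m. line_limit M n m = line_limit M m n \<and> conductance M n m = conductance M m n
        \<and> susceptance M n m = susceptance M m n"
    using M unfolding energy_market_def by (elim conjE)
  then show "susceptance M n m = susceptance M m n" "conductance M n m = conductance M m n" by metis+
  show "finite (distcos M)"
    using M unfolding energy_market_def by (elim conjE)
  show "finite (gencos M)"
    using M unfolding energy_market_def by (elim conjE)
  show "finite (transcos M)"
    using M unfolding energy_market_def by (elim conjE)
  show "disjoint_family_on (owned_lines M) (transcos M)"
    using M unfolding energy_market_def by (elim conjE)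
  show "(\<Union>i\<in>transcos M. owned_lines M i) = edges M"
    using M unfolding energy_market_def by (elim conjE)
qed

lemma
  assumes M: "energy_market M"
  shows utility_strongly_concave: "i \<in> distcos M \<Longrightarrow> n \<in> elastic_buses M i \<Longrightarrow>
      strongly_concave_on {load_lo M i n..load_hi M i n} (utility M i n)"
    and gen_cost_strongly_convex: "j \<in> gencos M \<Longrightarrow> n \<in> gen_buses M j \<Longrightarrow>
      strongly_convex_on {gen_lo M j n..gen_hi M j n} (gen_cost M j n)"
proof -
  have "\<forall>i\<in>distcos M. \<forall>n\<in>elastic_buses M i.
      strongly_concave_on {load_lo M i n..load_hi M i n} (utility M i n)"
    using M unfolding energy_market_def by (elim conjE)
  then show "i \<in> distcos M \<Longrightarrow> n \<in> elastic_buses M i \<Longrightarrow>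
      strongly_concave_on {load_lo M i n..load_hi M i n} (utility M i n)" by blast
  have "\<forall>j\<in>gencos M. \<forall>n\<in>gen_buses M j.
      strongly_convex_on {gen_lo M j n..gen_hi M j n} (gen_cost M j n)"
    using M unfolding energy_market_def by (elim conjE)
  then show "j \<in> gencos M \<Longrightarrow> n \<in> gen_buses M j \<Longrightarrow>
      strongly_convex_on {gen_lo M j n..gen_hi M j n} (gen_cost M j n)" by blast
qed

abbreviation line_surplus ::
  "('n::finite, 'd, 'g, 't) market \<Rightarrow> ('n \<Rightarrow> real) \<Rightarrow> real ^ 'n \<Rightarrow> 'n \<Rightarrow> 'n \<Rightarrow> real" where
  "line_surplus M \<theta> lam n m \<equiv>
     (lam $ m - lam $ n) * susceptance M n m * (\<theta> n - \<theta> m)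
       - (lam $ n + lam $ m) * (1 / 2 * conductance M n m * (\<theta> n - \<theta> m)\<^sup>2)"

text \<open>
  Every line has exactly one owner, and pairs of buses that are no line carry zero conductance
  and susceptance; so the ownership structure disappears from the total surplus, which becomes a
  sum over all ordered pairs of buses.
\<close>

lemma total_transco_surplus_eq_sum_lines:
  assumes M: "energy_market M"
  shows "total_transco_surplus M \<theta> lam
    = 1 / 2 * (\<Sum>(n, m)\<in>UNIV. line_surplus M \<theta> lam n m)"
proof -
  define P where "P i = {(n, m). {n, m} \<in> owned_lines M i}" for i
  note own = owned_lines_Union[OF M] finite_agents(3)[OF M] owned_lines_disjoint[OF M]
  have "transco_surplus M i (restrict \<theta> (transco_buses M i)) lam
      = 1 / 2 * (\<Sum>(n, m)\<in>P i. line_surplus M \<theta> lam n m)" for i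
    unfolding transco_surplus_def P_def[symmetric]
    by (intro arg_cong[where f = "(*) (1 / 2)"] sum.cong)
       (auto simp: P_def transco_buses_def restrict_def)
  then have "total_transco_surplus M \<theta> lam
      = 1 / 2 * (\<Sum>i\<in>transcos M. \<Sum>(n, m)\<in>P i. line_surplus M \<theta> lam n m)"
    unfolding total_transco_surplus_def by (simp add: sum_distrib_left)
  also have "(\<Sum>i\<in>transcos M. \<Sum>(n, m)\<in>P i. line_surplus M \<theta> lam n m)
      = (\<Sum>(n, m)\<in>(\<Union>i\<in>transcos M. P i). line_surplus M \<theta> lam n m)"
    using own(2,3)
    by (intro sum.UNION_disjoint[symmetric]) (auto simp: P_def disjoint_family_on_def)
  also have "\<dots> = (\<Sum>(n, m)\<in>UNIV. line_surplus M \<theta> lam n m)"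
  proof (rule sum.mono_neutral_left)
    show "\<forall>z\<in>UNIV - (\<Union>i\<in>transcos M. P i). (case z of (n, m) \<Rightarrow> line_surplus M \<theta> lam n m) = 0"
    proof
      fix z assume z: "z \<in> UNIV - (\<Union>i\<in>transcos M. P i)"
      obtain n m where nm: "z = (n, m)" by (cases z)
      have "{n, m} \<notin> edges M" using z own(1) unfolding nm P_def by blast
      then show "(case z of (n, m) \<Rightarrow> line_surplus M \<theta> lam n m) = 0"
        using line_data_zero[OF M] nm by simp
    qed
  qed auto
  finally show ?thesis .
qed

text \<open>
  The summand of an ordered pair is \<open>- (\<lambda>\<^sub>n g(\<theta>\<^sub>n\<^sub>m) + \<lambda>\<^sub>m g(\<theta>\<^sub>m\<^sub>n))\<close>; both orientations
  contribute the same after exchanging the order of summation, which cancels the factor one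
  half.
\<close>

lemma total_transco_surplus_eq_injection:
  assumes M: "energy_market M"
  shows "total_transco_surplus M \<theta> lam = - (\<Sum>n\<in>UNIV. lam $ n * injection M \<theta> n)"
proof -
  let ?F = "\<lambda>n m. lam $ n * flow M \<theta> n m"
  have "line_surplus M \<theta> lam n m = - (?F n m + ?F m n)" for n m
    unfolding flow_def line_data_sym[OF M, of m n] by (simp add: field_simps power2_eq_square)
  then have "(\<Sum>(n, m)\<in>UNIV. line_surplus M \<theta> lam n m)
      = (\<Sum>n\<in>UNIV. \<Sum>m\<in>UNIV. - (?F n m + ?F m n))"
    by (simp only: sum.cartesian_product UNIV_Times_UNIV)
  also have "\<dots> = - (\<Sum>n\<in>UNIV. \<Sum>m\<in>UNIV. ?F n m + ?F m n)"
    by (simp only: sum_negf)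
  also have "(\<Sum>n\<in>UNIV. \<Sum>m\<in>UNIV. ?F n m + ?F m n)
      = (\<Sum>n\<in>UNIV. \<Sum>m\<in>UNIV. ?F n m) + (\<Sum>n\<in>UNIV. \<Sum>m\<in>UNIV. ?F m n)"
    by (simp add: sum.distrib)
  also have "(\<Sum>n\<in>UNIV. \<Sum>m\<in>UNIV. ?F m n) = (\<Sum>n\<in>UNIV. \<Sum>m\<in>UNIV. ?F n m)"
    by (rule sum.swap)
  finally show ?thesis
    unfolding total_transco_surplus_eq_sum_lines[OF M] injection_def
    by (simp add: sum_distrib_left)
qed

text \<open>
  Separability is what makes decentralized responses work: at fixed prices the Lagrangian splits
  into the objectives of the individual agents, so maximizing it jointly is the same as each
  company maximizing its own surplus, with the transmission companies acting jointly.
\<close>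

lemma lagrangian_eq_total_surplus:
  assumes M: "energy_market M"
  shows "lagrangian M (e, p, \<theta>) lam
    = (\<Sum>i\<in>distcos M. distco_surplus M i (e i) lam)
      + (\<Sum>i\<in>gencos M. genco_surplus M i (p i) lam) + total_transco_surplus M \<theta> lam"
proof -
  note fin = finite_agents(1,2)[OF M]
  have swap: "(\<Sum>n\<in>UNIV. lam $ n * (\<Sum>i\<in>{i\<in>A. n \<in> B i}. q i n)) = (\<Sum>i\<in>A. \<Sum>n\<in>B i. lam $ n * q i n)"
    if "finite A" for A :: "'z set" and B q
    using sum.swap_restrict[of UNIV A "\<lambda>n i. lam $ n * q i n" "\<lambda>n i. n \<in> B i"] that
    by (simp add: sum_distrib_left)
  have "lam \<bullet> imbalance M (e, p, \<theta>)
      = (\<Sum>n\<in>UNIV. lam $ n * injection M \<theta> n) - (\<Sum>n\<in>UNIV. lam $ n * net_gen M p n)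
        + (\<Sum>n\<in>UNIV. lam $ n * net_elastic M e n) + (\<Sum>n\<in>UNIV. lam $ n * net_inelastic M n)"
    unfolding imbalance_def inner_vec_def
    by (simp add: algebra_simps sum.distrib sum_subtractf)
  then show ?thesis
    unfolding lagrangian_def welfare_def net_gen_def net_elastic_def net_inelastic_def
      swap[OF fin(1)] swap[OF fin(2)] total_transco_surplus_eq_injection[OF M]
      distco_surplus_def genco_surplus_def
    by (simp add: sum_subtractf)
qed

section \<open>Quadratic control of the imbalance\<close>

text \<open>
  A quantity \<open>q\<close> is controlled at \<open>x\<close> if its squared deviation from \<open>q x\<close> is at most a constant
  times \<open>gap\<close>. This is stable under sums, so control of the single loads, generations and line
  flows passes to the imbalance. Two gaps are used: the constant 1, where control means
  boundedness, and the Lagrangian suboptimality, where control means quadratic growth.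
\<close>

definition sq_controlled ::
  "'b set \<Rightarrow> ('b \<Rightarrow> real) \<Rightarrow> 'b \<Rightarrow> ('b \<Rightarrow> real) \<Rightarrow> bool" where
  "sq_controlled X gap x q \<longleftrightarrow> (\<exists>C. \<forall>y\<in>X. (q y - q x)\<^sup>2 \<le> C * gap y)"

lemma sq_controlledI:
  "(\<And>y. y \<in> X \<Longrightarrow> (q y - q x)\<^sup>2 \<le> C * gap y) \<Longrightarrow> sq_controlled X gap x q"
  unfolding sq_controlled_def by blast

lemma sq_controlled_const: "sq_controlled X gap x (\<lambda>_. c)"
  by (rule sq_controlledI[where C = 0]) simp

lemma sq_controlled_add:
  assumes "sq_controlled X gap x q" "sq_controlled X gap x r"
  shows "sq_controlled X gap x (\<lambda>y. q y + r y)"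
proof -
  obtain C D where C: "\<And>y. y \<in> X \<Longrightarrow> (q y - q x)\<^sup>2 \<le> C * gap y"
    and D: "\<And>y. y \<in> X \<Longrightarrow> (r y - r x)\<^sup>2 \<le> D * gap y"
    using assms unfolding sq_controlled_def by blast
  show ?thesis
  proof (rule sq_controlledI[where C = "2 * C + 2 * D"])
    fix y assume y: "y \<in> X"
    have "(q y + r y - (q x + r x))\<^sup>2 \<le> 2 * (q y - q x)\<^sup>2 + 2 * (r y - r x)\<^sup>2"
      using zero_le_power2[of "(q y - q x) - (r y - r x)"]
      by (simp add: power2_eq_square algebra_simps)
    then show "(q y + r y - (q x + r x))\<^sup>2 \<le> (2 * C + 2 * D) * gap y"
      using C[OF y] D[OF y] by (simp add: algebra_simps)
  qed
qed

lemma sq_controlled_minus: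
  "sq_controlled X gap x q \<Longrightarrow> sq_controlled X gap x (\<lambda>y. - q y)"
  unfolding sq_controlled_def by (simp add: power2_commute)

lemma sq_controlled_diff:
  "sq_controlled X gap x q \<Longrightarrow> sq_controlled X gap x r \<Longrightarrow> sq_controlled X gap x (\<lambda>y. q y - r y)"
  using sq_controlled_add[OF _ sq_controlled_minus] by fastforce

lemma sq_controlled_sum:
  assumes "\<And>i. i \<in> I \<Longrightarrow> sq_controlled X gap x (q i)"
  shows "sq_controlled X gap x (\<lambda>y. \<Sum>i\<in>I. q i y)"
  using assms
  by (induction I rule: infinite_finite_induct) (auto intro: sq_controlled_const sq_controlled_add)

lemma imbalance_sq_controlled:
  assumes load: "\<And>i n. i \<in> distcos M \<Longrightarrow> n \<in> elastic_buses M i \<Longrightarrow>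
      sq_controlled X gap x (\<lambda>(e, p, \<theta>). e i n)"
    and gen: "\<And>i n. i \<in> gencos M \<Longrightarrow> n \<in> gen_buses M i \<Longrightarrow>
      sq_controlled X gap x (\<lambda>(e, p, \<theta>). p i n)"
    and flow: "\<And>n m. sq_controlled X gap x (\<lambda>(e, p, \<theta>). flow M \<theta> n m)"
    and gap: "\<And>y. y \<in> X \<Longrightarrow> 0 \<le> gap y"
  shows "\<exists>C>0. \<forall>y\<in>X. (norm (imbalance M y - imbalance M x))\<^sup>2 \<le> C * gap y"
proof -
  have "sq_controlled X gap x (\<lambda>y. imbalance M y $ n)" for n
  proof -
    have "(\<lambda>y. imbalance M y $ n) = (\<lambda>y.
        (\<Sum>m\<in>UNIV. (\<lambda>(e, p, \<theta>). flow M \<theta> n m) y)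
        - (\<Sum>i\<in>{i\<in>gencos M. n \<in> gen_buses M i}. (\<lambda>(e, p, \<theta>). p i n) y)
        + (\<Sum>i\<in>{i\<in>distcos M. n \<in> elastic_buses M i}. (\<lambda>(e, p, \<theta>). e i n) y)
        + net_inelastic M n)"
      by (auto simp: imbalance_def injection_def net_gen_def net_elastic_def)
    then show ?thesis
      by (auto intro!: sq_controlled_add sq_controlled_diff sq_controlled_sum sq_controlled_const
          load gen flow)
  qed
  then obtain C where C: "\<And>n y. y \<in> X \<Longrightarrow> (imbalance M y $ n - imbalance M x $ n)\<^sup>2 \<le> C n * gap y"
    unfolding sq_controlled_def by metis
  define D where "D = 1 + (\<Sum>n\<in>UNIV. \<bar>C n\<bar>)"
  have "0 < D"
    unfolding D_def by (simp add: add_pos_nonneg sum_nonneg)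
  moreover have "(norm (imbalance M y - imbalance M x))\<^sup>2 \<le> D * gap y" if y: "y \<in> X" for y
  proof -
    have "(norm (imbalance M y - imbalance M x))\<^sup>2
        = (\<Sum>n\<in>UNIV. (imbalance M y $ n - imbalance M x $ n)\<^sup>2)"
      unfolding power2_norm_eq_inner inner_vec_def by (simp add: power2_eq_square)
    also have "\<dots> \<le> (\<Sum>n\<in>UNIV. C n * gap y)"
      using C[OF y] by (rule sum_mono)
    also have "\<dots> \<le> (\<Sum>n\<in>UNIV. \<bar>C n\<bar> * gap y)"
      using gap[OF y] by (intro sum_mono mult_right_mono) auto
    also have "\<dots> \<le> D * gap y"
      using gap[OF y] unfolding D_def by (simp add: distrib_right sum_distrib_right)
    finally show ?thesis .
  qed
  ultimately show ?thesis by blast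
qed

lemma separable_minimizer_coordinate:
  fixes f :: "'n \<Rightarrow> real \<Rightarrow> real"
  assumes A: "finite A" and e: "e \<in> Pi\<^sub>E A S"
    and min: "\<And>y. y \<in> Pi\<^sub>E A S \<Longrightarrow> (\<Sum>n\<in>A. f n (e n)) \<le> (\<Sum>n\<in>A. f n (y n))"
    and n: "n \<in> A" and v: "v \<in> S n"
  shows "f n (e n) \<le> f n v"
proof -
  have "e(n := v) \<in> Pi\<^sub>E A S"
    using e n v by (auto simp: PiE_iff extensional_def)
  from min[OF this] show ?thesis
    using A n by (simp add: sum.remove[of A n])
qed

text \<open>
  Compare the minimizer \<open>w\<close> with the midpoint of \<open>v\<close> and \<open>w\<close>: minimality bounds the value at the
  midpoint from below, strong convexity bounds it from above with the gain \<open>k / 8 (v - w)\<^sup>2\<close>.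
  The linear term, which carries the price, does not affect strong convexity.
\<close>

lemma strongly_convex_quadratic_growth:
  assumes conv: "strongly_convex_on {a..b} f" and w: "w \<in> {a..b}"
    and min: "\<And>v. v \<in> {a..b} \<Longrightarrow> f w + l * w \<le> f v + l * v"
  shows "\<exists>C\<ge>0. \<forall>v\<in>{a..b}. (v - w)\<^sup>2 \<le> C * ((f v + l * v) - (f w + l * w))"
proof -
  obtain k where k: "k > 0" and K: "\<And>x y t. x \<in> {a..b} \<Longrightarrow> y \<in> {a..b} \<Longrightarrow> t \<in> {0..1} \<Longrightarrow>
      f (t * x + (1 - t) * y) \<le> t * f x + (1 - t) * f y - k / 2 * t * (1 - t) * (x - y)\<^sup>2"
    using conv unfolding strongly_convex_on_def by blast
  have "(v - w)\<^sup>2 \<le> 4 / k * ((f v + l * v) - (f w + l * w))" if v: "v \<in> {a..b}" for v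
  proof -
    have "f ((v + w) / 2) \<le> f v / 2 + f w / 2 - k / 8 * (v - w)\<^sup>2"
      using K[OF v w, of "1 / 2"] by (simp add: add_divide_distrib)
    moreover have "f w + l * w \<le> f ((v + w) / 2) + l * ((v + w) / 2)"
      using v w by (intro min) (auto simp: field_simps)
    ultimately have "k / 4 * (v - w)\<^sup>2 \<le> (f v + l * v) - (f w + l * w)"
      by (simp add: field_simps)
    then show ?thesis using k by (simp add: field_simps)
  qed
  then show ?thesis using k by (intro exI[of _ "4 / k"]) auto
qed

text \<open>
  Changing one coordinate of the minimizer of a separable cost on a box shows that every
  coordinate minimizes its own summand. So all summands of the suboptimality are nonnegative,
  and the one that is strongly convex bounds the squared deviation of its coordinate.
\<close>

lemma separable_quadratic_growth:
  fixes c :: "'n \<Rightarrow> real \<Rightarrow> real"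
  assumes A: "finite A" and e: "e \<in> (\<Pi>\<^sub>E k\<in>A. {a k..b k})"
    and min: "\<And>y. y \<in> (\<Pi>\<^sub>E k\<in>A. {a k..b k}) \<Longrightarrow>
      (\<Sum>k\<in>A. c k (e k) + l k * e k) \<le> (\<Sum>k\<in>A. c k (y k) + l k * y k)"
    and n: "n \<in> A" and conv: "strongly_convex_on {a n..b n} (c n)"
  shows "\<exists>C\<ge>0. \<forall>y\<in>(\<Pi>\<^sub>E k\<in>A. {a k..b k}). (y n - e n)\<^sup>2
    \<le> C * ((\<Sum>k\<in>A. c k (y k) + l k * y k) - (\<Sum>k\<in>A. c k (e k) + l k * e k))"
proof -
  define f where "f k v = c k v + l k * v" for k v
  have coordinate: "f k (e k) \<le> f k v" if "k \<in> A" "v \<in> {a k..b k}" for k v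
    by (rule separable_minimizer_coordinate[OF A e _ that]) (use min in \<open>simp add: f_def\<close>)
  have "e n \<in> {a n..b n}" using e n by blast
  then obtain C where C: "C \<ge> 0" "\<And>v. v \<in> {a n..b n} \<Longrightarrow> (v - e n)\<^sup>2 \<le> C * (f n v - f n (e n))"
    using strongly_convex_quadratic_growth[OF conv, of "e n" "l n"] coordinate[OF n]
    unfolding f_def by blast
  have "(y n - e n)\<^sup>2 \<le> C * ((\<Sum>k\<in>A. f k (y k)) - (\<Sum>k\<in>A. f k (e k)))"
    if y: "y \<in> (\<Pi>\<^sub>E k\<in>A. {a k..b k})" for y
  proof -
    have y': "y k \<in> {a k..b k}" if "k \<in> A" for k using y that by blast
    have "(y n - e n)\<^sup>2 \<le> C * (f n (y n) - f n (e n))"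
      using C(2)[OF y'[OF n]] .
    also have "\<dots> \<le> C * (\<Sum>k\<in>A. f k (y k) - f k (e k))"
      using A n C(1) coordinate y'
      by (intro mult_left_mono member_le_sum[of n _ "\<lambda>k. f k (y k) - f k (e k)"]) auto
    finally show ?thesis by (simp add: sum_subtractf)
  qed
  with C(1) show ?thesis unfolding f_def by blast
qed

lemma angle_set_line_bounds:
  assumes M: "energy_market M" and \<theta>: "\<theta> \<in> angle_set M" and nm: "{n, m} \<in> edges M"
  shows "\<bar>\<theta> n - \<theta> m\<bar> \<le> 2 * pi"
proof -
  have "{n, m} \<in> (\<Union>i\<in>transcos M. owned_lines M i)"
    using nm owned_lines_Union[OF M] by simp
  then obtain i where i: "i \<in> transcos M" "{n, m} \<in> owned_lines M i" by blast
  then have buses: "n \<in> transco_buses M i" "m \<in> transco_buses M i"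
    unfolding transco_buses_def by blast+
  have "restrict \<theta> (transco_buses M i) \<in> transco_angle_set M i"
    using \<theta> i(1) unfolding angle_set_def by blast
  then have "\<theta> n \<in> {-pi..pi}" "\<theta> m \<in> {-pi..pi}"
    using buses unfolding transco_angle_set_def by auto
  then show ?thesis by auto
qed

text \<open>
  On angle differences in \<open>[- 2 pi, 2 pi]\<close> the quadratic flow function is Lipschitz with
  constant \<open>B + 2 pi G\<close>.
\<close>

lemma flow_diff_le:
  assumes M: "energy_market M" and \<theta>: "\<theta> \<in> angle_set M" "\<theta>' \<in> angle_set M"
    and nm: "{n, m} \<in> edges M"
  shows "(flow M \<theta> n m - flow M \<theta>' n m)\<^sup>2
    \<le> (susceptance M n m + 2 * pi * conductance M n m)\<^sup>2 * ((\<theta> n - \<theta> m) - (\<theta>' n - \<theta>' m))\<^sup>2"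
proof -
  define a b where "a = \<theta> n - \<theta> m" and "b = \<theta>' n - \<theta>' m"
  have pos: "susceptance M n m > 0" "conductance M n m > 0"
    using line_data_pos[OF M nm] by auto
  have ab: "\<bar>a + b\<bar> \<le> 4 * pi"
    using angle_set_line_bounds[OF M \<theta>(1) nm] angle_set_line_bounds[OF M \<theta>(2) nm]
    unfolding a_def b_def by linarith
  have "flow M \<theta> n m - flow M \<theta>' n m
      = (susceptance M n m + 1 / 2 * conductance M n m * (a + b)) * (a - b)"
    unfolding flow_def a_def[symmetric] b_def[symmetric]
    by (simp add: field_simps power2_eq_square)
  moreover have "\<bar>susceptance M n m + 1 / 2 * conductance M n m * (a + b)\<bar>
      \<le> susceptance M n m + 2 * pi * conductance M n m"
  proof -
    define r where "r = 1 / 2 * conductance M n m * (a + b)"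
    have "\<bar>r\<bar> \<le> 1 / 2 * conductance M n m * (4 * pi)"
      unfolding r_def abs_mult using pos ab by (intro mult_mono) auto
    then show ?thesis using pos unfolding r_def[symmetric] by (auto simp: abs_le_iff mult_ac)
  qed
  then have "(susceptance M n m + 1 / 2 * conductance M n m * (a + b))\<^sup>2
      \<le> (susceptance M n m + 2 * pi * conductance M n m)\<^sup>2"
    by (metis abs_ge_zero power2_abs power_mono)
  ultimately show ?thesis
    unfolding a_def[symmetric] b_def[symmetric] by (simp add: power_mult_distrib mult_right_mono)
qed

text \<open>
  It suffices to control angle differences along lines, since all other flows vanish; the angles
  themselves enter the surplus only through these differences.
\<close>

lemma flow_sq_controlled:
  assumes M: "energy_market M" and x: "x \<in> dispatch_set M"
    and D: "{n, m} \<in> edges M \<Longrightarrow> sq_controlled (dispatch_set M) gap x (\<lambda>(e, p, \<theta>). \<theta> n - \<theta> m)"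
  shows "sq_controlled (dispatch_set M) gap x (\<lambda>(e, p, \<theta>). flow M \<theta> n m)"
proof (cases "{n, m} \<in> edges M")
  case True
  define K where "K = (susceptance M n m + 2 * pi * conductance M n m)\<^sup>2"
  obtain C where C: "\<And>y. y \<in> dispatch_set M \<Longrightarrow>
      ((\<lambda>(e, p, \<theta>). \<theta> n - \<theta> m) y - (\<lambda>(e, p, \<theta>). \<theta> n - \<theta> m) x)\<^sup>2 \<le> C * gap y"
    using D[OF True] unfolding sq_controlled_def by blast
  show ?thesis
  proof (rule sq_controlledI[where C = "K * C"])
    fix y assume y: "y \<in> dispatch_set M"
    obtain e p \<theta> e' p' \<theta>' where xy: "y = (e, p, \<theta>)" "x = (e', p', \<theta>')"
      by (metis prod_cases3)
    have "(flow M \<theta> n m - flow M \<theta>' n m)\<^sup>2 \<le> K * ((\<theta> n - \<theta> m) - (\<theta>' n - \<theta>' m))\<^sup>2"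
      unfolding K_def using x y True by (intro flow_diff_le[OF M]) (auto simp: xy dispatch_set_def)
    also have "\<dots> \<le> K * (C * gap y)"
      using C[OF y] unfolding xy by (intro mult_left_mono) (auto simp: K_def)
    finally show "((\<lambda>(e, p, \<theta>). flow M \<theta> n m) y - (\<lambda>(e, p, \<theta>). flow M \<theta> n m) x)\<^sup>2 \<le> K * C * gap y"
      by (simp add: xy mult.assoc)
  qed
next
  case False
  have "susceptance M n m = 0" "conductance M n m = 0"
    using line_data_zero[OF M False] by auto
  then show ?thesis
    by (auto simp: flow_def intro!: sq_controlledI[where C = 0])
qed

lemma imbalance_bounded:
  assumes M: "energy_market M" 
  shows "\<exists>H. \<forall>y\<in>dispatch_set M. norm (imbalance M y) \<le> H"
proof (cases "dispatch_set M = {}")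
  case False
  then obtain x where x: "x \<in> dispatch_set M" by blast
  obtain e p \<theta> where x_eq: "x = (e, p, \<theta>)" by (cases x)
  have bounded: "(u - v)\<^sup>2 \<le> (b - a)\<^sup>2" if "u \<in> {a..b}" "v \<in> {a..b}" for u v a b :: real
    using that by (intro power2_le_iff_abs_le[THEN iffD2]) auto
  have "\<exists>C>0. \<forall>y\<in>dispatch_set M. (norm (imbalance M y - imbalance M x))\<^sup>2 \<le> C * (\<lambda>_. 1) y"
  proof (rule imbalance_sq_controlled)
    fix i n assume i: "i \<in> distcos M" "n \<in> elastic_buses M i"
    show "sq_controlled (dispatch_set M) (\<lambda>_. 1) x (\<lambda>(e, p, \<theta>). e i n)"
      using x i by (intro sq_controlledI[where C = "(load_hi M i n - load_lo M i n)\<^sup>2"])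
        (fastforce simp: x_eq dispatch_set_def load_set_def PiE_iff intro!: bounded)
  next
    fix i n assume i: "i \<in> gencos M" "n \<in> gen_buses M i"
    show "sq_controlled (dispatch_set M) (\<lambda>_. 1) x (\<lambda>(e, p, \<theta>). p i n)"
      using x i by (intro sq_controlledI[where C = "(gen_hi M i n - gen_lo M i n)\<^sup>2"])
        (fastforce simp: x_eq dispatch_set_def gen_set_def PiE_iff intro!: bounded)
  next
    fix n m
    show "sq_controlled (dispatch_set M) (\<lambda>_. 1) x (\<lambda>(e, p, \<theta>). flow M \<theta> n m)"
    proof (rule flow_sq_controlled[OF M x])
      assume nm: "{n, m} \<in> edges M"
      show "sq_controlled (dispatch_set M) (\<lambda>_. 1) x (\<lambda>(e, p, \<theta>). \<theta> n - \<theta> m)"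
      proof (rule sq_controlledI[where C = "(2 * pi - - (2 * pi))\<^sup>2"])
        fix y assume y: "y \<in> dispatch_set M"
        obtain e' p' \<theta>' where y_eq: "y = (e', p', \<theta>')" by (cases y)
        have "\<theta>' \<in> angle_set M" "\<theta> \<in> angle_set M"
          using x y by (auto simp: x_eq y_eq dispatch_set_def)
        then have "\<bar>\<theta>' n - \<theta>' m\<bar> \<le> 2 * pi" "\<bar>\<theta> n - \<theta> m\<bar> \<le> 2 * pi"
          using angle_set_line_bounds[OF M _ nm] by blast+
        then have "(\<theta>' n - \<theta>' m - (\<theta> n - \<theta> m))\<^sup>2 \<le> (2 * pi - - (2 * pi))\<^sup>2"
          by (intro bounded) (auto simp: abs_le_iff)
        then show "((\<lambda>(e, p, \<theta>). \<theta> n - \<theta> m) y - (\<lambda>(e, p, \<theta>). \<theta> n - \<theta> m) x)\<^sup>2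
            \<le> (2 * pi - - (2 * pi))\<^sup>2 * 1"
          by (simp add: x_eq y_eq)
      qed
    qed
  qed auto
  then obtain C where C: "\<And>y. y \<in> dispatch_set M \<Longrightarrow> (norm (imbalance M y - imbalance M x))\<^sup>2 \<le> C"
    by auto
  have "norm (imbalance M y) \<le> norm (imbalance M x) + sqrt C" if "y \<in> dispatch_set M" for y
    using real_le_rsqrt[OF C[OF that]] norm_triangle_ineq2[of "imbalance M y" "imbalance M x"]
    by linarith
  then show ?thesis by blast
qed auto

section \<open>Quadratic growth of the Lagrangian at a price response\<close>

text \<open>
  A line has both endpoints among the buses of its owner, so the constraints of a company may be
  stated for the unrestricted angle profile.
\<close>

lemma restrict_in_transco_angle_set_iff:
  "restrict \<theta> (transco_buses M i) \<in> transco_angle_set M i \<longleftrightarrow>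
    (\<forall>n m. {n, m} \<in> owned_lines M i \<longrightarrow> flow M \<theta> n m \<le> line_limit M n m \<and>
        angle_lo M n m \<le> \<theta> n - \<theta> m \<and> \<theta> n - \<theta> m \<le> angle_hi M n m) \<and>
    (\<forall>n\<in>transco_buses M i \<inter> slack_buses M. \<theta> n = 0) \<and>
    (\<forall>n\<in>transco_buses M i. \<theta> n \<in> {-pi..pi})"
proof -
  define N where "N = transco_buses M i"
  have N: "n \<in> N" "m \<in> N" if "{n, m} \<in> owned_lines M i" for n m
    using that unfolding N_def transco_buses_def by blast+
  have "restrict \<theta> N n - restrict \<theta> N m = \<theta> n - \<theta> m"
    "flow M (restrict \<theta> N) n m = flow M \<theta> n m" if "{n, m} \<in> owned_lines M i" for n m
    using N[OF that] by (simp_all add: flow_def)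
  then show ?thesis
    unfolding transco_angle_set_def N_def[symmetric] by simp
qed

text \<open>
  Flow limits are sublevel sets of convex quadratic functions and all other constraints are
  linear. The midpoint has the value \<open>(undefined + undefined) / 2 = undefined\<close> off the network,
  so it is extensional.
\<close>

lemma angle_set_midpoint:
  assumes M: "energy_market M" and \<theta>: "\<theta> \<in> angle_set M" and \<theta>': "\<theta>' \<in> angle_set M"
  shows "(\<lambda>n. (\<theta> n + \<theta>' n) / 2) \<in> angle_set M"
proof -
  define \<mu> where "\<mu> n = (\<theta> n + \<theta>' n) / 2" for n
  have "restrict \<mu> (transco_buses M i) \<in> transco_angle_set M i" if i: "i \<in> transcos M" for i
  proof -
    note iff = restrict_in_transco_angle_set_iff
    have \<theta>i: "restrict \<theta> (transco_buses M i) \<in> transco_angle_set M i"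
      "restrict \<theta>' (transco_buses M i) \<in> transco_angle_set M i"
      using \<theta> \<theta>' i unfolding angle_set_def by blast+
    have line: "flow M \<mu> n m \<le> line_limit M n m \<and>
        angle_lo M n m \<le> \<mu> n - \<mu> m \<and> \<mu> n - \<mu> m \<le> angle_hi M n m"
      if nm: "{n, m} \<in> owned_lines M i" for n m
    proof -
      have bounds: "flow M \<theta> n m \<le> line_limit M n m" "angle_lo M n m \<le> \<theta> n - \<theta> m"
        "\<theta> n - \<theta> m \<le> angle_hi M n m" "flow M \<theta>' n m \<le> line_limit M n m"
        "angle_lo M n m \<le> \<theta>' n - \<theta>' m" "\<theta>' n - \<theta>' m \<le> angle_hi M n m"
        using \<theta>i nm unfolding iff by blast+
      have "{n, m} \<in> edges M" using nm i owned_lines_Union[OF M] by blast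
      then have G: "conductance M n m > 0" using line_data_pos[OF M] by blast
      have "flow M \<mu> n m = flow M \<theta> n m / 2 + flow M \<theta>' n m / 2
          - conductance M n m * ((\<theta> n - \<theta> m) - (\<theta>' n - \<theta>' m))\<^sup>2 / 8"
        unfolding flow_def \<mu>_def by (simp add: field_simps power2_eq_square)
      moreover have "0 \<le> conductance M n m * ((\<theta> n - \<theta> m) - (\<theta>' n - \<theta>' m))\<^sup>2 / 8"
        using G by simp
      ultimately have "flow M \<mu> n m \<le> line_limit M n m" using bounds(1,4) by linarith
      then show ?thesis using bounds unfolding \<mu>_def by (auto simp: field_simps)
    qed
    have "\<mu> n = 0" if "n \<in> transco_buses M i \<inter> slack_buses M" for n
    proof -
      have "\<theta> n = 0" "\<theta>' n = 0" using \<theta>i that unfolding iff by blast+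
      then show ?thesis unfolding \<mu>_def by simp
    qed
    moreover have "\<mu> n \<in> {-pi..pi}" if "n \<in> transco_buses M i" for n
    proof -
      have "\<theta> n \<in> {-pi..pi}" "\<theta>' n \<in> {-pi..pi}"
        using \<theta>i that unfolding iff by blast+
      then show ?thesis unfolding \<mu>_def by auto
    qed
    ultimately show ?thesis
      using line unfolding iff by blast
  qed
  moreover have "\<mu> \<in> extensional (\<Union>i\<in>transcos M. transco_buses M i)"
    using \<theta> \<theta>' unfolding angle_set_def extensional_def \<mu>_def by auto
  ultimately show ?thesis unfolding angle_set_def \<mu>_def[symmetric] by blast
qed

text \<open>
  This is where positive edge-wise price sums enter. They make the total surplus a concave
  quadratic function of the angle differences whose value at a midpoint exceeds the mean of the
  two values by \<open>1/16\<close> of the sum of \<open>(\<lambda>\<^sub>k + \<lambda>\<^sub>l) G\<^sub>k\<^sub>l \<Delta>\<^sub>k\<^sub>l\<^sup>2\<close> over ordered pairs. The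
  midpoint is admissible and cannot beat the optimum, so the suboptimality is at least \<open>1/8\<close> of
  that sum.
\<close>

lemma transco_quadratic_growth:
  assumes M: "energy_market M" and pos: "edge_positive M lam"
    and opt: "is_arg_max (\<lambda>y. total_transco_surplus M y lam) (\<lambda>y. y \<in> angle_set M) \<theta>'"
    and nm: "{n, m} \<in> edges M"
  shows "\<exists>C\<ge>0. \<forall>\<theta>\<in>angle_set M. ((\<theta> n - \<theta> m) - (\<theta>' n - \<theta>' m))\<^sup>2
    \<le> C * (total_transco_surplus M \<theta>' lam - total_transco_surplus M \<theta> lam)"
proof -
  define w where "w n m = (lam $ n + lam $ m) * conductance M n m" for n m
  have \<theta>': "\<theta>' \<in> angle_set M"
    and max: "\<And>\<theta>. \<theta> \<in> angle_set M \<Longrightarrow> total_transco_surplus M \<theta> lam \<le> total_transco_surplus M \<theta>' lam"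
    using opt unfolding is_arg_max_linorder by auto
  have w_nonneg: "0 \<le> w k l" for k l
  proof (cases "{k, l} \<in> edges M")
    case True
    have "conductance M k l > 0" "lam $ k + lam $ l > 0"
      using line_data_pos[OF M True] pos True unfolding edge_positive_def by auto
    then show ?thesis unfolding w_def by simp
  next
    case False
    then have "conductance M k l = 0" using line_data_zero[OF M] by blast
    then show ?thesis unfolding w_def by simp
  qed
  have w_pos: "0 < w n m"
  proof -
    have "conductance M n m > 0" "lam $ n + lam $ m > 0"
      using line_data_pos[OF M nm] pos nm unfolding edge_positive_def by auto
    then show ?thesis unfolding w_def by simp
  qed
  have "((\<theta> n - \<theta> m) - (\<theta>' n - \<theta>' m))\<^sup>2
      \<le> 8 / w n m * (total_transco_surplus M \<theta>' lam - total_transco_surplus M \<theta> lam)"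
    if \<theta>: "\<theta> \<in> angle_set M" for \<theta>
  proof -
    define \<mu> where "\<mu> n = (\<theta> n + \<theta>' n) / 2" for n
    define \<Delta> where "\<Delta> n m = (\<theta> n - \<theta> m) - (\<theta>' n - \<theta>' m)" for n m
    have pointwise: "line_surplus M \<mu> lam k l
        = (line_surplus M \<theta> lam k l + line_surplus M \<theta>' lam k l) / 2 + w k l * (\<Delta> k l)\<^sup>2 / 8" for k l
      unfolding \<mu>_def \<Delta>_def w_def by (simp add: field_simps power2_eq_square)
    define Q where "Q = (\<Sum>(k, l)\<in>UNIV. w k l * (\<Delta> k l)\<^sup>2)"
    have "total_transco_surplus M \<mu> lam
        = (total_transco_surplus M \<theta> lam + total_transco_surplus M \<theta>' lam) / 2
          + 1 / 16 * Q"
      unfolding Q_def total_transco_surplus_eq_sum_lines[OF M] pointwise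
      by (simp add: case_prod_unfold sum.distrib sum_divide_distrib[symmetric] add_divide_distrib)
    moreover have "total_transco_surplus M \<mu> lam \<le> total_transco_surplus M \<theta>' lam"
      using angle_set_midpoint[OF M \<theta> \<theta>'] unfolding \<mu>_def by (rule max)
    moreover have "w n m * (\<Delta> n m)\<^sup>2 \<le> Q"
      using member_le_sum[of "(n, m)" UNIV "\<lambda>(k, l). w k l * (\<Delta> k l)\<^sup>2"] w_nonneg unfolding Q_def by auto
    ultimately have "w n m * (\<Delta> n m)\<^sup>2
        \<le> 8 * (total_transco_surplus M \<theta>' lam - total_transco_surplus M \<theta> lam)"
      by (simp add: field_simps)
    then show ?thesis
      using w_pos unfolding \<Delta>_def[symmetric] by (simp add: field_simps)
  qed
  then show ?thesis using w_pos by (intro exI[of _ "8 / w n m"]) auto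
qed

lemma price_response_maximizes_lagrangian:
  assumes M: "energy_market M" and resp: "price_response M lam x" and y: "y \<in> dispatch_set M"
  shows "lagrangian M y lam \<le> lagrangian M x lam"
proof -
  obtain e p \<theta> e' p' \<theta>' where xy: "x = (e, p, \<theta>)" "y = (e', p', \<theta>')"
    by (metis prod_cases3)
  show ?thesis
    using resp y unfolding xy lagrangian_eq_total_surplus[OF M] price_response_def
      is_arg_max_linorder dispatch_set_def
    by (intro add_mono sum_mono) auto
qed

lemma price_response_in_dispatch_set:
  "price_response M lam x \<Longrightarrow> x \<in> dispatch_set M"
  unfolding price_response_def dispatch_set_def is_arg_max_linorder by auto

lemma distco_quadratic_growth:
  assumes M: "energy_market M" and i: "i \<in> distcos M" and n: "n \<in> elastic_buses M i"
    and opt: "is_arg_max (\<lambda>y. distco_surplus M i y lam) (\<lambda>y. y \<in> load_set M i) e"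
  shows "\<exists>C\<ge>0. \<forall>y\<in>load_set M i. (y n - e n)\<^sup>2
    \<le> C * (distco_surplus M i e lam - distco_surplus M i y lam)"
proof -
  have surplus: "distco_surplus M i y lam
      = - (\<Sum>k\<in>elastic_buses M i. - utility M i k (y k) + lam $ k * y k)
        - (\<Sum>k\<in>inelastic_buses M i. lam $ k * inelastic_load M i k)" for y
    unfolding distco_surplus_def by (simp add: sum_subtractf sum.distrib sum_negf)
  have e: "e \<in> load_set M i"
    and max: "\<And>y. y \<in> load_set M i \<Longrightarrow> distco_surplus M i y lam \<le> distco_surplus M i e lam"
    using opt unfolding is_arg_max_linorder by auto
  have conv: "strongly_convex_on {load_lo M i n..load_hi M i n} (\<lambda>v. - utility M i n v)"
    using utility_strongly_concave[OF M i n] unfolding strongly_concave_on_def .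
  show ?thesis
    using separable_quadratic_growth[OF finite e[unfolded load_set_def],
        of "\<lambda>k v. - utility M i k v" "\<lambda>k. lam $ k", OF _ n conv] max
    unfolding surplus load_set_def by simp
qed

lemma genco_quadratic_growth:
  assumes M: "energy_market M" and i: "i \<in> gencos M" and n: "n \<in> gen_buses M i"
    and opt: "is_arg_max (\<lambda>y. genco_surplus M i y lam) (\<lambda>y. y \<in> gen_set M i) p"
  shows "\<exists>C\<ge>0. \<forall>y\<in>gen_set M i. (y n - p n)\<^sup>2
    \<le> C * (genco_surplus M i p lam - genco_surplus M i y lam)"
proof -
  have surplus: "genco_surplus M i y lam
      = - (\<Sum>k\<in>gen_buses M i. gen_cost M i k (y k) + - lam $ k * y k)" for y
    unfolding genco_surplus_def by (simp add: sum_subtractf sum.distrib sum_negf)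
  have p: "p \<in> gen_set M i"
    and max: "\<And>y. y \<in> gen_set M i \<Longrightarrow> genco_surplus M i y lam \<le> genco_surplus M i p lam"
    using opt unfolding is_arg_max_linorder by auto
  show ?thesis
    using separable_quadratic_growth[OF finite p[unfolded gen_set_def],
        of "gen_cost M i" "\<lambda>k. - lam $ k", OF _ n gen_cost_strongly_convex[OF M i n]] max
    unfolding surplus gen_set_def by simp
qed

text \<open>
  The suboptimality of a dispatch is the sum of the nonnegative suboptimalities of the agents,
  so each of them is bounded by it, and the growth of the agents' surpluses controls every load,
  generation and line flow, hence the imbalance.
\<close>

lemma lagrangian_quadratic_growth:
  assumes M: "energy_market M" and pos: "edge_positive M lam" and resp: "price_response M lam x"
  shows "\<exists>C>0. \<forall>y\<in>dispatch_set M. (norm (imbalance M y - imbalance M x))\<^sup>2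
    \<le> C * (lagrangian M x lam - lagrangian M y lam)"
proof -
  let ?X = "dispatch_set M" and ?gap = "\<lambda>y. lagrangian M x lam - lagrangian M y lam"
  obtain e p \<theta> where x_eq: "x = (e, p, \<theta>)" by (cases x)
  have x: "x \<in> ?X" using resp by (rule price_response_in_dispatch_set)
  note fin = finite_agents(1,2)[OF M]
  have opt: "\<And>i. i \<in> distcos M \<Longrightarrow>
      is_arg_max (\<lambda>y. distco_surplus M i y lam) (\<lambda>y. y \<in> load_set M i) (e i)"
    "\<And>i. i \<in> gencos M \<Longrightarrow>
      is_arg_max (\<lambda>y. genco_surplus M i y lam) (\<lambda>y. y \<in> gen_set M i) (p i)"
    "is_arg_max (\<lambda>y. total_transco_surplus M y lam) (\<lambda>y. y \<in> angle_set M) \<theta>"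
    using resp unfolding price_response_def x_eq by auto
  have parts: "(\<forall>i\<in>distcos M. distco_surplus M i (e i) lam - distco_surplus M i (e' i) lam \<le> ?gap (e', p', \<theta>')) \<and>
      (\<forall>i\<in>gencos M. genco_surplus M i (p i) lam - genco_surplus M i (p' i) lam \<le> ?gap (e', p', \<theta>')) \<and>
      total_transco_surplus M \<theta> lam - total_transco_surplus M \<theta>' lam \<le> ?gap (e', p', \<theta>')"
    if y: "(e', p', \<theta>') \<in> ?X" for e' p' \<theta>'
  proof -
    define d where "d i = distco_surplus M i (e i) lam - distco_surplus M i (e' i) lam" for i
    define g where "g i = genco_surplus M i (p i) lam - genco_surplus M i (p' i) lam" for i
    define s where "s = total_transco_surplus M \<theta> lam - total_transco_surplus M \<theta>' lam"
    have d: "\<And>i. i \<in> distcos M \<Longrightarrow> 0 \<le> d i" and g: "\<And>i. i \<in> gencos M \<Longrightarrow> 0 \<le> g i" and s: "0 \<le> s"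
      using opt y unfolding d_def g_def s_def dispatch_set_def is_arg_max_linorder by auto
    have "?gap (e', p', \<theta>') = sum d (distcos M) + sum g (gencos M) + s"
      unfolding x_eq lagrangian_eq_total_surplus[OF M] d_def g_def s_def
      by (simp add: sum_subtractf)
    moreover have "d i \<le> sum d (distcos M)" if "i \<in> distcos M" for i
      using that d fin by (intro member_le_sum) auto
    moreover have "g i \<le> sum g (gencos M)" if "i \<in> gencos M" for i
      using that g fin by (intro member_le_sum) auto
    moreover have "0 \<le> sum d (distcos M)" "0 \<le> sum g (gencos M)"
      using d g by (auto intro: sum_nonneg)
    ultimately show ?thesis
      using s unfolding d_def[symmetric] g_def[symmetric] s_def[symmetric] by fastforce
  qed
  show ?thesis
  proof (rule imbalance_sq_controlled)
    fix i n assume i: "i \<in> distcos M" "n \<in> elastic_buses M i"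
    obtain C where C: "C \<ge> 0" "\<And>y. y \<in> load_set M i \<Longrightarrow>
        (y n - e i n)\<^sup>2 \<le> C * (distco_surplus M i (e i) lam - distco_surplus M i y lam)"
      using distco_quadratic_growth[OF M i opt(1)[OF i(1)]] by blast
    show "sq_controlled ?X ?gap x (\<lambda>(e, p, \<theta>). e i n)"
    proof (rule sq_controlledI[where C = C], clarify)
      fix e' p' \<theta>' assume y: "(e', p', \<theta>') \<in> ?X"
      then have "(e' i n - e i n)\<^sup>2 \<le> C * (distco_surplus M i (e i) lam - distco_surplus M i (e' i) lam)"
        using i by (intro C(2)) (auto simp: dispatch_set_def)
      also have "\<dots> \<le> C * ?gap (e', p', \<theta>')"
        using parts[OF y] i(1) C(1) by (intro mult_left_mono) auto
      finally show "(e' i n - (\<lambda>(e, p, \<theta>). e i n) x)\<^sup>2 \<le> C * ?gap (e', p', \<theta>')"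
        by (simp add: x_eq)
    qed
  next
    fix i n assume i: "i \<in> gencos M" "n \<in> gen_buses M i"
    obtain C where C: "C \<ge> 0" "\<And>y. y \<in> gen_set M i \<Longrightarrow>
        (y n - p i n)\<^sup>2 \<le> C * (genco_surplus M i (p i) lam - genco_surplus M i y lam)"
      using genco_quadratic_growth[OF M i opt(2)[OF i(1)]] by blast
    show "sq_controlled ?X ?gap x (\<lambda>(e, p, \<theta>). p i n)"
    proof (rule sq_controlledI[where C = C], clarify)
      fix e' p' \<theta>' assume y: "(e', p', \<theta>') \<in> ?X"
      then have "(p' i n - p i n)\<^sup>2 \<le> C * (genco_surplus M i (p i) lam - genco_surplus M i (p' i) lam)"
        using i by (intro C(2)) (auto simp: dispatch_set_def)
      also have "\<dots> \<le> C * ?gap (e', p', \<theta>')"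
        using parts[OF y] i(1) C(1) by (intro mult_left_mono) auto
      finally show "(p' i n - (\<lambda>(e, p, \<theta>). p i n) x)\<^sup>2 \<le> C * ?gap (e', p', \<theta>')"
        by (simp add: x_eq)
    qed
  next
    fix n m
    show "sq_controlled ?X ?gap x (\<lambda>(e, p, \<theta>). flow M \<theta> n m)"
    proof (rule flow_sq_controlled[OF M x])
      assume nm: "{n, m} \<in> edges M"
      obtain C where C: "C \<ge> 0" "\<And>\<theta>'. \<theta>' \<in> angle_set M \<Longrightarrow> ((\<theta>' n - \<theta>' m) - (\<theta> n - \<theta> m))\<^sup>2
          \<le> C * (total_transco_surplus M \<theta> lam - total_transco_surplus M \<theta>' lam)"
        using transco_quadratic_growth[OF M pos opt(3) nm] by blast
      show "sq_controlled ?X ?gap x (\<lambda>(e, p, \<theta>). \<theta> n - \<theta> m)"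
      proof (rule sq_controlledI[where C = C], clarify)
        fix e' p' \<theta>' assume y: "(e', p', \<theta>') \<in> ?X"
        then have "((\<theta>' n - \<theta>' m) - (\<theta> n - \<theta> m))\<^sup>2
            \<le> C * (total_transco_surplus M \<theta> lam - total_transco_surplus M \<theta>' lam)"
          by (intro C(2)) (auto simp: dispatch_set_def)
        also have "\<dots> \<le> C * ?gap (e', p', \<theta>')"
          using parts[OF y] C(1) by (intro mult_left_mono) auto
        finally show "(\<theta>' n - \<theta>' m - (\<lambda>(e, p, \<theta>). \<theta> n - \<theta> m) x)\<^sup>2 \<le> C * ?gap (e', p', \<theta>')"
          by (simp add: x_eq)
      qed
    qed
  next
    fix y assume "y \<in> ?X"
    then show "0 \<le> ?gap y"
      using price_response_maximizes_lagrangian[OF M resp] by simp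
  qed
qed

section \<open>The dual function\<close>

text \<open>
  The Lagrangian is affine in the prices with slope minus the imbalance; all properties of the
  dual function below rest on this.
\<close>

lemma lagrangian_price_shift:
  "lagrangian M y \<nu> = lagrangian M y \<mu> - (\<nu> - \<mu>) \<bullet> imbalance M y"
  unfolding lagrangian_def by (simp add: inner_diff_left)

text \<open>
  The dual function is a supremum of reals and meaningful only if the Lagrangian is bounded
  above. At one price vector a response attains the maximum, and passing to other prices changes
  the Lagrangian by a bounded amount because the imbalance is bounded.
\<close>

lemma lagrangian_le_dual_function:
  assumes M: "energy_market M" and resp: "price_response M \<mu> x" and y: "y \<in> dispatch_set M"
  shows "lagrangian M y \<nu> \<le> dual_function M \<nu>"
  unfolding dual_function_def
proof (rule cSUP_upper[OF y])
  obtain H where H: "\<And>z. z \<in> dispatch_set M \<Longrightarrow> norm (imbalance M z) \<le> H"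
    using imbalance_bounded[OF M] by blast
  have "lagrangian M z \<nu> \<le> lagrangian M x \<mu> + norm (\<nu> - \<mu>) * H" if z: "z \<in> dispatch_set M" for z
  proof -
    have "\<bar>(\<nu> - \<mu>) \<bullet> imbalance M z\<bar> \<le> norm (\<nu> - \<mu>) * H"
      using Cauchy_Schwarz_ineq2 H[OF z] by (rule order_trans[OF _ mult_left_mono]) simp
    then show ?thesis
      using price_response_maximizes_lagrangian[OF M resp z] lagrangian_price_shift[of M z \<nu> \<mu>]
      by linarith
  qed
  then show "bdd_above ((\<lambda>z. lagrangian M z \<nu>) ` dispatch_set M)"
    by (intro bdd_aboveI2)
qed

lemma dual_function_le:
  assumes "dispatch_set M \<noteq> {}" and "\<And>y. y \<in> dispatch_set M \<Longrightarrow> lagrangian M y \<nu> \<le> c"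
  shows "dual_function M \<nu> \<le> c"
  unfolding dual_function_def using assms by (rule cSUP_least)

lemma dual_function_eq_lagrangian:
  assumes M: "energy_market M" and resp: "price_response M \<mu> x"
  shows "dual_function M \<mu> = lagrangian M x \<mu>"
proof (rule antisym)
  note x = price_response_in_dispatch_set[OF resp]
  show "dual_function M \<mu> \<le> lagrangian M x \<mu>"
    using x price_response_maximizes_lagrangian[OF M resp] by (intro dual_function_le) auto
  show "lagrangian M x \<mu> \<le> dual_function M \<mu>"
    using lagrangian_le_dual_function[OF M resp x] .
qed

lemma dual_function_subgradient:
  assumes M: "energy_market M" and resp: "price_response M \<mu> x"
  shows "dual_function M \<mu> + (- imbalance M x) \<bullet> (\<nu> - \<mu>) \<le> dual_function M \<nu>"
  using lagrangian_le_dual_function[OF M resp price_response_in_dispatch_set[OF resp], of \<nu>]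
    lagrangian_price_shift[of M x \<nu> \<mu>] dual_function_eq_lagrangian[OF M resp]
  by (simp add: inner_commute)

text \<open>
  As a supremum of functions of the prices whose slopes are bounded by \<open>H\<close>, the dual function is
  Lipschitz.
\<close>

lemma dual_function_continuous:
  assumes M: "energy_market M" and resp: "price_response M \<mu> x"
  shows "continuous_on UNIV (dual_function M)"
proof -
  obtain H where H: "\<And>z. z \<in> dispatch_set M \<Longrightarrow> norm (imbalance M z) \<le> H"
    using imbalance_bounded[OF M] by blast
  note x = price_response_in_dispatch_set[OF resp]
  have H0: "0 \<le> H" using H[OF x] norm_ge_zero order_trans by blast
  have one_sided: "dual_function M \<nu> \<le> dual_function M \<kappa> + H * dist \<nu> \<kappa>" for \<nu> \<kappa>
  proof (rule dual_function_le)
    fix z assume z: "z \<in> dispatch_set M"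
    have "\<bar>(\<nu> - \<kappa>) \<bullet> imbalance M z\<bar> \<le> norm (\<nu> - \<kappa>) * H"
      using Cauchy_Schwarz_ineq2 H[OF z] by (rule order_trans[OF _ mult_left_mono]) simp
    then show "lagrangian M z \<nu> \<le> dual_function M \<kappa> + H * dist \<nu> \<kappa>"
      using lagrangian_le_dual_function[OF M resp z, of \<kappa>] lagrangian_price_shift[of M z \<nu> \<kappa>]
      by (simp add: dist_norm mult.commute)
  qed (use x in blast)
  have "H-lipschitz_on UNIV (dual_function M)"
  proof (rule lipschitz_onI[OF _ H0])
    fix \<nu> \<kappa> :: "real ^ 'a"
    show "dist (dual_function M \<nu>) (dual_function M \<kappa>) \<le> H * dist \<nu> \<kappa>"
      using one_sided[of \<nu> \<kappa>] one_sided[of \<kappa> \<nu>] by (simp add: dist_real_def dist_commute abs_le_iff)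
  qed
  then show ?thesis by (rule lipschitz_on_continuous_on)
qed

text \<open>
  Quadratic growth stands in for differentiability of the dual function: it yields the bound
  \<open>\<phi>(\<mu> + \<delta>) \<le> \<phi>(\<mu>) - \<delta> \<bullet> h + C/4 \<bar>\<delta>\<bar>\<^sup>2\<close>, where \<open>h\<close> is the imbalance of the response. The
  right-hand side, with \<open>C\<close> the growth constant, is least at \<open>\<delta> = (2 / C) h\<close>, where it is
  \<open>\<phi>(\<mu>) - \<bar>h\<bar>\<^sup>2 / C\<close>; at a minimizer of the dual function this forces \<open>h = 0\<close>.
\<close>

lemma response_at_dual_minimizer_balances:
  assumes M: "energy_market M" and pos: "edge_positive M \<mu>" and resp: "price_response M \<mu> x"
    and min: "\<And>\<nu>. dual_function M \<mu> \<le> dual_function M \<nu>"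
  shows "imbalance M x = 0"
proof -
  define h where "h = imbalance M x"
  obtain C where C: "C > 0" and growth: "\<And>y. y \<in> dispatch_set M \<Longrightarrow>
      (norm (imbalance M y - h))\<^sup>2 \<le> C * (lagrangian M x \<mu> - lagrangian M y \<mu>)"
    using lagrangian_quadratic_growth[OF M pos resp] unfolding h_def by blast
  have "dual_function M (\<mu> + (2 / C) *\<^sub>R h) \<le> dual_function M \<mu> - (norm h)\<^sup>2 / C"
  proof (rule dual_function_le)
    fix y assume y: "y \<in> dispatch_set M"
    have "(norm (imbalance M y - h))\<^sup>2 = (norm (imbalance M y))\<^sup>2 - 2 * (h \<bullet> imbalance M y) + (norm h)\<^sup>2"
      unfolding power2_norm_eq_inner by (simp add: inner_diff_left inner_diff_right inner_commute)
    then have "(norm h)\<^sup>2 - 2 * (h \<bullet> imbalance M y) \<le> C * (lagrangian M x \<mu> - lagrangian M y \<mu>)"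
      using growth[OF y] zero_le_power2[of "norm (imbalance M y)"] by linarith
    then have "((norm h)\<^sup>2 - 2 * (h \<bullet> imbalance M y)) / C \<le> lagrangian M x \<mu> - lagrangian M y \<mu>"
      using C by (simp add: pos_divide_le_eq mult.commute)
    then have "lagrangian M y \<mu> - (2 / C) * (h \<bullet> imbalance M y) \<le> lagrangian M x \<mu> - (norm h)\<^sup>2 / C"
      by (simp add: diff_divide_distrib)
    then show "lagrangian M y (\<mu> + (2 / C) *\<^sub>R h) \<le> dual_function M \<mu> - (norm h)\<^sup>2 / C"
      using lagrangian_price_shift[of M y "\<mu> + (2 / C) *\<^sub>R h" \<mu>] dual_function_eq_lagrangian[OF M resp]
      by simp
  qed (use price_response_in_dispatch_set[OF resp] in blast)
  with min[of "\<mu> + (2 / C) *\<^sub>R h"] have "(norm h)\<^sup>2 / C \<le> 0" by linarith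
  then have "h = 0" using C by (simp add: divide_le_0_iff)
  then show ?thesis unfolding h_def .
qed

section \<open>Equilibrium and welfare\<close>

text \<open>
  For balanced dispatches the Lagrangian is the welfare, and the response maximizes the
  Lagrangian over all dispatches.
\<close>

lemma balanced_response_welfare_optimal:
  assumes M: "energy_market M" and resp: "price_response M \<mu> x" and bal: "imbalance M x = 0"
  shows "welfare_optimal M x"
proof -
  have "welfare M y \<le> welfare M x" if "y \<in> feasible_set M" for y
    using price_response_maximizes_lagrangian[OF M resp, of y] that bal
    unfolding feasible_set_def lagrangian_def by simp
  then show ?thesis
    using price_response_in_dispatch_set[OF resp] bal
    unfolding welfare_optimal_def is_arg_max_linorder feasible_set_def by auto
qed

text \<open>
  A deviation of one company that keeps the angles of its shared buses extends by the old angles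
  to a consistent profile. The surpluses of the other companies are unchanged, so a profitable
  deviation would raise the total surplus.
\<close>

lemma joint_optimum_individually_optimal:
  assumes M: "energy_market M" and i: "i \<in> transcos M"
    and opt: "is_arg_max (\<lambda>y. total_transco_surplus M y lam) (\<lambda>y. y \<in> angle_set M) \<theta>"
  shows "is_arg_max (\<lambda>y. transco_surplus M i y lam)
    (\<lambda>y. y \<in> transco_angle_set M i \<and> (\<forall>n\<in>shared_buses M i. y n = \<theta> n))
    (restrict \<theta> (transco_buses M i))"
proof -
  define N where "N = transco_buses M"
  have \<theta>: "\<theta> \<in> angle_set M"
    and max: "\<And>y. y \<in> angle_set M \<Longrightarrow> total_transco_surplus M y lam \<le> total_transco_surplus M \<theta> lam"
    using opt unfolding is_arg_max_linorder by auto
  have fin: "finite (transcos M)" by (rule finite_agents[OF M])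
  have "transco_surplus M i y lam \<le> transco_surplus M i (restrict \<theta> (N i)) lam"
    if y: "y \<in> transco_angle_set M i" and agree: "\<forall>n\<in>shared_buses M i. y n = \<theta> n" for y
  proof -
    define \<eta> where "\<eta> n = (if n \<in> N i then y n else \<theta> n)" for n
    have own: "restrict \<eta> (N i) = y"
      using y unfolding transco_angle_set_def N_def \<eta>_def
      by (auto simp: restrict_def extensional_def fun_eq_iff)
    have other: "restrict \<eta> (N j) = restrict \<theta> (N j)" if "j \<in> transcos M" "j \<noteq> i" for j
      using agree that unfolding \<eta>_def shared_buses_def N_def by (auto simp: restrict_def fun_eq_iff)
    have "restrict \<eta> (N j) \<in> transco_angle_set M j" if "j \<in> transcos M" for j
      using own other[OF that] y \<theta> that unfolding angle_set_def N_def by (cases "j = i") auto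
    moreover have "\<eta> \<in> extensional (\<Union>j\<in>transcos M. N j)"
      using \<theta> i unfolding angle_set_def \<eta>_def N_def by (auto simp: extensional_def)
    ultimately have "\<eta> \<in> angle_set M" unfolding angle_set_def N_def by blast
    from max[OF this] show ?thesis
      unfolding total_transco_surplus_def N_def[symmetric] using own other
      by (simp add: sum.remove[OF fin i])
  qed
  moreover have "restrict \<theta> (N i) \<in> transco_angle_set M i"
    using \<theta> i unfolding angle_set_def N_def by blast
  ultimately show ?thesis
    unfolding is_arg_max_linorder N_def by (auto simp: shared_buses_def)
qed

lemma balanced_response_competitive_equilibrium:
  assumes M: "energy_market M" and resp: "price_response M \<mu> x" and bal: "imbalance M x = 0"
    and \<epsilon>: "\<epsilon> > 0"
  shows "competitive_equilibrium M \<epsilon> x \<mu>"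
proof -
  obtain e p \<theta> where x: "x = (e, p, \<theta>)" by (cases x)
  have "injection M \<theta> n - net_gen M p n + net_elastic M e n + net_inelastic M n = 0" for n
    using arg_cong[OF bal, of "\<lambda>v. v $ n"] unfolding x imbalance_def by simp
  then show ?thesis
    using resp \<epsilon> joint_optimum_individually_optimal[OF M]
    unfolding x competitive_equilibrium_def price_response_def by auto
qed

theorem theorem1:
  fixes M :: "('n::finite, 'd, 'g, 't) market"
    and x :: "real ^ 'n \<Rightarrow> ('n, 'd, 'g) dispatch"
    and \<alpha> :: "nat \<Rightarrow> real"
    and lam :: "nat \<Rightarrow> real ^ 'n"
  assumes market: "energy_market M"
    and feasible: "feasible_set M \<noteq> {}"
    and dual_attained: "\<exists>\<mu>. \<forall>\<nu>. dual_function M \<mu> \<le> dual_function M \<nu>"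
    and response: "\<And>\<mu>. edge_positive M \<mu> \<Longrightarrow> price_response M \<mu> (x \<mu>)"
    and steps: "step_sizes \<alpha>"
    and process: "pricing_process M x \<alpha> lam"
    and positive: "\<And>t. edge_positive M (lam t)"
    and positive_limit: "\<And>\<mu>. lam \<longlonglongrightarrow> \<mu> \<Longrightarrow> edge_positive M \<mu>"
  shows "\<exists>lam_star. lam \<longlonglongrightarrow> lam_star \<and>
           (\<forall>\<epsilon>>0. competitive_equilibrium M \<epsilon> (x lam_star) lam_star) \<and>
           welfare_optimal M (x lam_star)"
proof -
  have resp: "price_response M (lam t) (x (lam t))" for t
    by (rule response[OF positive])
  obtain H where H: "\<And>y. y \<in> dispatch_set M \<Longrightarrow> norm (imbalance M y) \<le> H"
    using imbalance_bounded[OF market] by blast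
  have "\<exists>l. lam \<longlonglongrightarrow> l \<and> (\<forall>\<nu>. dual_function M l \<le> dual_function M \<nu>)"
  proof (rule square_summable_subgradient_descent_converges)
    show "lam (Suc t) = lam t - \<alpha> t *\<^sub>R (- imbalance M (x (lam t)))" for t
      using process unfolding pricing_process_def by simp
    show "dual_function M (lam t) + (- imbalance M (x (lam t))) \<bullet> (\<nu> - lam t)
        \<le> dual_function M \<nu>" for t \<nu>
      by (rule dual_function_subgradient[OF market resp])
    show "norm (- imbalance M (x (lam t))) \<le> H" for t
      using H[OF price_response_in_dispatch_set[OF resp]] by simp
    show "continuous_on UNIV (dual_function M)"
      by (rule dual_function_continuous[OF market resp])
  qed (use dual_attained steps in \<open>auto simp: step_sizes_def\<close>)
  then obtain l where l: "lam \<longlonglongrightarrow> l" "\<And>\<nu>. dual_function M l \<le> dual_function M \<nu>"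
    by blast
  have pos: "edge_positive M l" by (rule positive_limit[OF l(1)])
  have bal: "imbalance M (x l) = 0"
    by (rule response_at_dual_minimizer_balances[OF market pos response[OF pos] l(2)])
  show ?thesis
    using l(1) balanced_response_competitive_equilibrium[OF market response[OF pos] bal]
      balanced_response_welfare_optimal[OF market response[OF pos] bal]
    by blast
qed

end
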